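(* Let $0<q<1$. Let $\mathbf{u}\in\mathcal{P}^*$ be a regular functional and let $(P_n)_{n\ge0}$ be the corresponding monic orthogonal polynomial sequence, with $P_{-1}:=0$. Then there exists a sequence of complex numbers $(k_n)_{n\ge0}$ such that $$\mathcal{D}_q\mathcal{S}_qP_n(z)=k_nP_{n-1}(z)\qquad(n=0,1,2,\ldots)$$ if and only if there is $s\in\{1,-1\}$ such that $\mathbf{u}$ satisfies the functional equations \begin{align*} q^{s/2}(q^s-1)\,\mathbf{S}_q\mathbf{D}_q\mathbf{u}&=2z\,\mathbf{u},\\ 4(\alpha^2-1)q^{5s/2}\,\mathbf{D}_q^2\big((z^2-\alpha^2)\mathbf{u}\big)&=(-4z^2+1-q^{2s})\,\mathbf{u},\\ 4q^{2s}\,\mathbf{S}_q^2\mathbf{u}&=\big(-4z^2+1+3q^{2s}\big)\mathbf{u},\\ 2q^{3s}(1-q^s)\,\mathbf{D}_q\mathbf{S}_q\big((z^2-\alpha^2)\mathbf{u}\big)&=z\,(-4z^2+q^{4s}+q^{2s}+2)\,\mathbf{u}, \end{align*} where $\alpha=\frac12(q^{1/2}+q^{-1/2})$.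
   Context: Let $\mathcal{P}$ be the space of polynomials in one variable $z$ with complex coefficients and $\mathcal{P}^*$ its algebraic dual. For $p\in\mathcal{P}$, with $z=x(\sigma)=\frac12(q^{\sigma}+q^{-\sigma})$, the Askey-Wilson operator $\mathcal{D}_q$ and the averaging operator $\mathcal{S}_q$ are the linear maps $\mathcal{P}\to\mathcal{P}$ defined by $$\mathcal{D}_q p(x(\sigma))=\frac{p(x(\sigma+\frac12))-p(x(\sigma-\frac12))}{x(\sigma+\frac12)-x(\sigma-\frac12)},\qquad \mathcal{S}_q p(x(\sigma))=\tfrac12\Big(p(x(\sigma+\tfrac12))+p(x(\sigma-\tfrac12))\Big).$$ On $\mathcal{P}^*$ define linear operators $\mathbf{D}_q,\mathbf{S}_q$ by $\langle\mathbf{D}_q\mathbf{w},f\rangle=-\langle\mathbf{w},\mathcal{D}_qf\rangle$ and $\langle\mathbf{S}_q\mathbf{w},f\rangle=\langle\mathbf{w},\mathcal{S}_qf\rangle$ for $f\in\mathcal{P}$, and the product of a polynomial $g$ with $\mathbf{w}\in\mathcal{P}^*$ by $\langle g\mathbf{w},f\rangle=\langle\mathbf{w},gf\rangle$. Squares of operators denote composition, and $z$ denotes the polynomial variable. A functional $\mathbf{u}\in\mathcal{P}^*$ is regular if there is a (then unique) sequence of monic polynomials $(P_n)_{n\ge0}$, $\deg P_n=n$, with $\langle\mathbf{u},P_jP_n\rangle=h_n\delta_{j,n}$ and $h_n\in\mathbb{C}\setminus\{0\}$ for all $j,n\ge0$; $(P_n)_{n\ge0}$ is the monic orthogonal polynomial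 sequence corresponding to $\mathbf{u}$. *)

theory Defs
  imports "HOL-Analysis.Analysis" "HOL-Computational_Algebra.Polynomial"
begin

section \<open>The Askey-Wilson and averaging operators\<close>

text \<open>The lattice \<open>x(\<sigma>) = (q\<^sup>\<sigma> + q\<^sup>-\<^sup>\<sigma>)/2\<close>, with \<open>\<sigma>\<close> ranging over the complex numbers; for
  \<open>0 < q\<close> the power is \<open>exp (\<sigma> ln q)\<close>.\<close>

definition aw_x :: "real \<Rightarrow> complex \<Rightarrow> complex" where
  "aw_x q \<sigma> = (complex_of_real q powr \<sigma> + complex_of_real q powr (- \<sigma>)) / 2"

definition aw_alpha :: "real \<Rightarrow> real" where
  "aw_alpha q = (q powr (1/2) + q powr (- (1/2))) / 2"

text \<open>Both operators are defined implicitly, by their values on the lattice. Existence and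
  uniqueness of the polynomials described here are proved below for \<open>0 < q < 1\<close>. In the first definition the
  points where the divided difference would be \<open>0/0\<close> are left out.\<close>

definition aw_Dq :: "real \<Rightarrow> complex poly \<Rightarrow> complex poly" where
  "aw_Dq q p = (THE r. \<forall>\<sigma>. aw_x q (\<sigma> + 1/2) \<noteq> aw_x q (\<sigma> - 1/2) \<longrightarrow>
     poly r (aw_x q \<sigma>) =
       (poly p (aw_x q (\<sigma> + 1/2)) - poly p (aw_x q (\<sigma> - 1/2))) /
       (aw_x q (\<sigma> + 1/2) - aw_x q (\<sigma> - 1/2)))"

definition aw_Sq :: "real \<Rightarrow> complex poly \<Rightarrow> complex poly" where
  "aw_Sq q p = (THE r. \<forall>\<sigma>. poly r (aw_x q \<sigma>) =
     (poly p (aw_x q (\<sigma> + 1/2)) + poly p (aw_x q (\<sigma> - 1/2))) / 2)"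

lemma aw_x_exp:
  assumes "0 < q"
  shows "aw_x q \<sigma> = (exp (\<sigma> * of_real (ln q)) + exp (- (\<sigma> * of_real (ln q)))) / 2"
  using assms by (simp add: aw_x_def powr_def Ln_of_real)

lemma aw_alpha_exp:
  assumes "0 < q"
  shows "complex_of_real (aw_alpha q) =
    (exp (of_real (ln q) / 2) + exp (- (of_real (ln q) / 2))) / 2"
  using assms by (simp add: aw_alpha_def powr_def exp_of_real[symmetric])

lemma aw_x_shift:
  assumes "0 < q"
  shows "aw_x q (\<sigma> + 1/2) + aw_x q (\<sigma> - 1/2) = 2 * of_real (aw_alpha q) * aw_x q \<sigma>" (is ?A)
    and "(aw_x q (\<sigma> + 1/2) - aw_x q (\<sigma> - 1/2))^2 =
           4 * (of_real (aw_alpha q)^2 - 1) * (aw_x q \<sigma>^2 - 1)" (is ?B)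
proof -
  define a where "a = exp (\<sigma> * complex_of_real (ln q))"
  define b where "b = exp (- (\<sigma> * complex_of_real (ln q)))"
  define t where "t = exp (complex_of_real (ln q) / 2)"
  define r where "r = exp (- (complex_of_real (ln q) / 2))"
  have ab: "a * b = 1" and tr: "t * r = 1"
    by (simp_all add: a_def b_def t_def r_def flip: exp_add)
  have p: "aw_x q (\<sigma> + 1/2) = (a * t + b * r) / 2"
    unfolding aw_x_exp[OF assms] a_def b_def t_def r_def exp_add[symmetric]
    by (simp add: algebra_simps)
  have m: "aw_x q (\<sigma> - 1/2) = (a * r + b * t) / 2"
    unfolding aw_x_exp[OF assms] a_def b_def t_def r_def exp_add[symmetric]
    by (simp add: algebra_simps)
  have x: "aw_x q \<sigma> = (a + b) / 2"
    unfolding aw_x_exp[OF assms] a_def b_def ..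
  have al: "of_real (aw_alpha q) = (t + r) / 2"
    unfolding aw_alpha_exp[OF assms] t_def r_def ..
  show ?A
    unfolding p m x al by (simp add: field_simps)
  have "4 * (aw_x q (\<sigma> + 1/2) - aw_x q (\<sigma> - 1/2))^2 = ((a - b) * (t - r))^2"
    unfolding p m by (simp add: power2_eq_square field_simps)
  also have "\<dots> = ((a + b)^2 - 4 * (a * b)) * ((t + r)^2 - 4 * (t * r))"
    by (simp add: power2_eq_square algebra_simps)
  also have "\<dots> = 4 * (4 * (of_real (aw_alpha q)^2 - 1) * (aw_x q \<sigma>^2 - 1))"
    unfolding ab tr x al by (simp add: power2_eq_square field_simps)
  finally show ?B by simp
qed

lemma aw_x_surj:
  assumes "0 < q" "q < 1"
  shows "\<exists>\<sigma>. aw_x q \<sigma> = z"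
proof -
  define w where "w = z + csqrt (z^2 - 1)"
  have e: "w * (z - csqrt (z^2 - 1)) = 1"
  proof -
    have "w * (z - csqrt (z^2 - 1)) = z^2 - (csqrt (z^2 - 1))^2"
      by (simp add: w_def power2_eq_square algebra_simps)
    then show ?thesis by simp
  qed
  then have w0: "w \<noteq> 0" by auto
  have iw: "inverse w = z - csqrt (z^2 - 1)"
    using e by (rule inverse_unique)
  have "complex_of_real (ln q) \<noteq> 0" using assms by simp
  then have "aw_x q (Ln w / of_real (ln q)) = (w + inverse w) / 2"
    using w0 assms by (simp add: aw_x_exp exp_minus)
  also have "\<dots> = z" unfolding iw by (simp add: w_def)
  finally show ?thesis by blast
qed

lemma poly_eq_off_finite:
  fixes r r' :: "complex poly"
  assumes "finite F" and "\<And>z. z \<notin> F \<Longrightarrow> poly r z = poly r' z"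
  shows "r = r'"
proof (rule ccontr)
  assume "r \<noteq> r'"
  then have "finite {z. poly (r - r') z = 0}" by (intro poly_roots_finite) simp
  moreover have "- F \<subseteq> {z. poly (r - r') z = 0}" using assms(2) by auto
  ultimately have "finite (- F)" by (rule rev_finite_subset)
  then have "finite (F \<union> - F)" using assms(1) by blast
  then show False by (simp add: infinite_UNIV_char_0)
qed

lemma aw_operators_exist:
  assumes "0 < q"
  shows "\<exists>d s. \<forall>\<sigma>.
    poly d (aw_x q \<sigma>) * (aw_x q (\<sigma> + 1/2) - aw_x q (\<sigma> - 1/2)) =
      poly p (aw_x q (\<sigma> + 1/2)) - poly p (aw_x q (\<sigma> - 1/2)) \<and>
    2 * poly s (aw_x q \<sigma>) = poly p (aw_x q (\<sigma> + 1/2)) + poly p (aw_x q (\<sigma> - 1/2))"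
proof (induction p)
  case 0
  show ?case by (rule exI[of _ 0], rule exI[of _ 0]) simp
next
  case (pCons c p)
  then obtain d s where
    d: "\<And>\<sigma>. poly d (aw_x q \<sigma>) * (aw_x q (\<sigma> + 1/2) - aw_x q (\<sigma> - 1/2)) =
        poly p (aw_x q (\<sigma> + 1/2)) - poly p (aw_x q (\<sigma> - 1/2))" and
    s: "\<And>\<sigma>. 2 * poly s (aw_x q \<sigma>) =
        poly p (aw_x q (\<sigma> + 1/2)) + poly p (aw_x q (\<sigma> - 1/2))"
    by blast
  define \<alpha> where "\<alpha> = complex_of_real (aw_alpha q)"
  define d' where "d' = s + [:0, \<alpha>:] * d"
  define s' where "s' = [:c:] + smult (\<alpha>^2 - 1) ([:-1, 0, 1:] * d) + [:0, \<alpha>:] * s"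
  have "poly d' (aw_x q \<sigma>) * (aw_x q (\<sigma> + 1/2) - aw_x q (\<sigma> - 1/2)) =
      poly (pCons c p) (aw_x q (\<sigma> + 1/2)) - poly (pCons c p) (aw_x q (\<sigma> - 1/2)) \<and>
    2 * poly s' (aw_x q \<sigma>) =
      poly (pCons c p) (aw_x q (\<sigma> + 1/2)) + poly (pCons c p) (aw_x q (\<sigma> - 1/2))" for \<sigma>
  proof -
    define x where "x = aw_x q \<sigma>"
    define y where "y = aw_x q (\<sigma> + 1/2)"
    define w where "w = aw_x q (\<sigma> - 1/2)"
    define D where "D = poly d x"
    define S where "S = poly s x"
    define A where "A = poly p y"
    define B where "B = poly p w"
    have 1: "D * (y - w) = A - B" and 2: "2 * S = A + B"
      using d[of \<sigma>] s[of \<sigma>] by (simp_all add: D_def S_def A_def B_def x_def y_def w_def)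
    have 3: "y + w = 2 * \<alpha> * x" and 4: "(y - w)^2 = 4 * (\<alpha>^2 - 1) * (x^2 - 1)"
      using aw_x_shift[OF assms, of \<sigma>] by (simp_all add: x_def y_def w_def \<alpha>_def)
    have "2 * ((S + \<alpha> * x * D) * (y - w)) = 2 * S * (y - w) + (2 * \<alpha> * x) * (D * (y - w))"
      by (simp add: algebra_simps)
    also have "\<dots> = (A + B) * (y - w) + (y + w) * (A - B)"
      unfolding 1 2 3[symmetric] ..
    also have "\<dots> = 2 * (y * A - w * B)" by (simp add: algebra_simps)
    finally have 5: "(S + \<alpha> * x * D) * (y - w) = y * A - w * B" by (simp only: mult_cancel_left) simp
    have "2 * (2 * (c + (\<alpha>^2 - 1) * (x^2 - 1) * D + \<alpha> * x * S)) =
        4 * c + (4 * (\<alpha>^2 - 1) * (x^2 - 1)) * D + (2 * \<alpha> * x) * (2 * S)"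
      by (simp add: algebra_simps)
    also have "\<dots> = 4 * c + (y - w) * (D * (y - w)) + (y + w) * (A + B)"
      unfolding 2 3[symmetric] 4[symmetric] by (simp add: power2_eq_square)
    also have "\<dots> = 2 * (2 * c + y * A + w * B)"
      unfolding 1 by (simp add: algebra_simps)
    finally have 6: "2 * (c + (\<alpha>^2 - 1) * (x^2 - 1) * D + \<alpha> * x * S) = 2 * c + y * A + w * B"
      by (simp only: mult_cancel_left) simp
    have 7: "poly d' x = S + \<alpha> * x * D"
      by (simp add: d'_def D_def S_def algebra_simps)
    have 8: "poly s' x = c + (\<alpha>^2 - 1) * (x^2 - 1) * D + \<alpha> * x * S"
      by (simp add: s'_def D_def S_def algebra_simps power2_eq_square)
    show ?thesis
      unfolding x_def[symmetric] y_def[symmetric] w_def[symmetric] 7 8 5 6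
      by (simp add: A_def B_def)
  qed
  then show ?case by blast
qed

lemma aw_x_shift_neq:
  assumes "0 < q" "q < 1" and "aw_x q \<sigma> \<notin> {1, -1}"
  shows "aw_x q (\<sigma> + 1/2) \<noteq> aw_x q (\<sigma> - 1/2)"
proof
  assume "aw_x q (\<sigma> + 1/2) = aw_x q (\<sigma> - 1/2)"
  then have "(complex_of_real (aw_alpha q)^2 - 1) * (aw_x q \<sigma>^2 - 1) = 0"
    using aw_x_shift(2)[OF assms(1), of \<sigma>] by simp
  moreover have "aw_x q \<sigma>^2 - 1 \<noteq> 0"
    using assms(3) by (auto simp: power2_eq_1_iff)
  ultimately have "complex_of_real (aw_alpha q^2) = complex_of_real 1" by simp
  then have al: "aw_alpha q^2 = 1" unfolding of_real_eq_iff .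
  have "q powr (1/2) * q powr (- (1/2)) = 1"
    using assms by (simp flip: powr_add)
  then have "4 * (aw_alpha q^2 - 1) = (q powr (1/2) - q powr (- (1/2)))^2"
    by (simp add: aw_alpha_def power2_eq_square field_simps)
  with al have "q powr (1/2) = q powr (- (1/2))" by simp
  then show False using assms by (simp add: powr_inj)
qed

lemma aw_Dq_ex1:
  assumes "0 < q" "q < 1"
  shows "\<exists>!r. \<forall>\<sigma>. aw_x q (\<sigma> + 1/2) \<noteq> aw_x q (\<sigma> - 1/2) \<longrightarrow>
     poly r (aw_x q \<sigma>) =
       (poly p (aw_x q (\<sigma> + 1/2)) - poly p (aw_x q (\<sigma> - 1/2))) /
       (aw_x q (\<sigma> + 1/2) - aw_x q (\<sigma> - 1/2))" (is "\<exists>!r. ?P r")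
proof (rule ex_ex1I)
  obtain d where d: "\<And>\<sigma>. poly d (aw_x q \<sigma>) * (aw_x q (\<sigma> + 1/2) - aw_x q (\<sigma> - 1/2)) =
      poly p (aw_x q (\<sigma> + 1/2)) - poly p (aw_x q (\<sigma> - 1/2))"
    using aw_operators_exist[OF assms(1), of p] by blast
  have "?P d"
  proof (intro allI impI)
    fix \<sigma> assume "aw_x q (\<sigma> + 1/2) \<noteq> aw_x q (\<sigma> - 1/2)"
    then have ne: "aw_x q (\<sigma> + 1/2) - aw_x q (\<sigma> - 1/2) \<noteq> 0"
      unfolding right_minus_eq .
    show "poly d (aw_x q \<sigma>) =
       (poly p (aw_x q (\<sigma> + 1/2)) - poly p (aw_x q (\<sigma> - 1/2))) /
       (aw_x q (\<sigma> + 1/2) - aw_x q (\<sigma> - 1/2))"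
      unfolding eq_divide_eq using ne d[of \<sigma>] by (simp only: if_True not_False_eq_True)
  qed
  then show "\<exists>r. ?P r" by (rule exI[of ?P d])
next
  fix r r' assume r: "?P r" and r': "?P r'"
  show "r = r'"
  proof (rule poly_eq_off_finite[of "{1, -1}"])
    fix z :: complex assume z: "z \<notin> {1, -1}"
    obtain \<sigma> where \<sigma>: "aw_x q \<sigma> = z" using aw_x_surj[OF assms] by blast
    have ne: "aw_x q (\<sigma> + 1/2) \<noteq> aw_x q (\<sigma> - 1/2)"
      using z unfolding \<sigma>[symmetric] by (rule aw_x_shift_neq[OF assms])
    show "poly r z = poly r' z"
      unfolding \<sigma>[symmetric] mp[OF spec[OF r, of \<sigma>] ne] mp[OF spec[OF r', of \<sigma>] ne] ..
  qed simp
qed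

lemma aw_Sq_ex1:
  assumes "0 < q" "q < 1"
  shows "\<exists>!r. \<forall>\<sigma>. poly r (aw_x q \<sigma>) =
     (poly p (aw_x q (\<sigma> + 1/2)) + poly p (aw_x q (\<sigma> - 1/2))) / 2" (is "\<exists>!r. ?P r")
proof (rule ex_ex1I)
  obtain s where s: "\<And>\<sigma>. 2 * poly s (aw_x q \<sigma>) =
      poly p (aw_x q (\<sigma> + 1/2)) + poly p (aw_x q (\<sigma> - 1/2))"
    using aw_operators_exist[OF assms(1), of p] by blast
  have "?P s" unfolding s[symmetric] by simp
  then show "\<exists>r. ?P r" ..
next
  fix r r' assume r: "?P r" and r': "?P r'"
  show "r = r'"
  proof (rule poly_eq_off_finite[of "{}"])
    fix z :: complex
    obtain \<sigma> where \<sigma>: "aw_x q \<sigma> = z" using aw_x_surj[OF assms] by blast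
    show "poly r z = poly r' z"
      unfolding \<sigma>[symmetric] spec[OF r, of \<sigma>] spec[OF r', of \<sigma>] ..
  qed simp
qed


section \<open>Linear functionals on polynomials\<close>

text \<open>An element of the algebraic dual is a function satisfying \<open>in_dual\<close>. The operations below
  are defined on all functions.\<close>

definition in_dual :: "(complex poly \<Rightarrow> complex) \<Rightarrow> bool" where
  "in_dual w \<longleftrightarrow> Vector_Spaces.linear smult (*) w"

definition dual_scale :: "complex \<Rightarrow> (complex poly \<Rightarrow> complex) \<Rightarrow> (complex poly \<Rightarrow> complex)" where
  "dual_scale c w = (\<lambda>f. c * w f)"

definition dual_mult :: "complex poly \<Rightarrow> (complex poly \<Rightarrow> complex) \<Rightarrow> (complex poly \<Rightarrow> complex)" where
  "dual_mult g w = (\<lambda>f. w (g * f))"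

definition dual_Dq :: "real \<Rightarrow> (complex poly \<Rightarrow> complex) \<Rightarrow> (complex poly \<Rightarrow> complex)" where
  "dual_Dq q w = (\<lambda>f. - w (aw_Dq q f))"

definition dual_Sq :: "real \<Rightarrow> (complex poly \<Rightarrow> complex) \<Rightarrow> (complex poly \<Rightarrow> complex)" where
  "dual_Sq q w = (\<lambda>f. w (aw_Sq q f))"

definition is_monic_OPS :: "(complex poly \<Rightarrow> complex) \<Rightarrow> (nat \<Rightarrow> complex poly) \<Rightarrow> bool" where
  "is_monic_OPS u P \<longleftrightarrow>
     (\<forall>n. degree (P n) = n \<and> lead_coeff (P n) = 1) \<and>
     (\<exists>h :: nat \<Rightarrow> complex. (\<forall>n. h n \<noteq> 0) \<and>
        (\<forall>j n. u (P j * P n) = (if j = n then h n else 0)))"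

definition regular_functional :: "(complex poly \<Rightarrow> complex) \<Rightarrow> bool" where
  "regular_functional u \<longleftrightarrow> in_dual u \<and> (\<exists>P. is_monic_OPS u P)"

abbreviation polyvar :: "complex poly" where
  "polyvar \<equiv> [:0, 1:]"

abbreviation polyconst :: "real \<Rightarrow> complex poly" where
  "polyconst c \<equiv> [:complex_of_real c:]"

end

theory Submission
  imports Defs
begin

text \<open>
  The operator \<open>T = \<D>\<^sub>q \<S>\<^sub>q\<close> is \<open>\<alpha>\<close> times the Askey-Wilson operator of base \<open>q\<^sup>2\<close>, and with \<open>z\<close>
  denoting multiplication by the variable it satisfies
  \<open>T z\<^sup>2 - 2 \<alpha>\<^sub>2 z T z + z\<^sup>2 T = (1 - \<alpha>\<^sub>2\<^sup>2) T\<close>, where \<open>\<alpha>\<^sub>2 = 2 \<alpha>\<^sup>2 - 1\<close>.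

  If \<open>T P\<^sub>n = k\<^sub>n P\<^sub>n\<^sub>-\<^sub>1\<close>, then applying this relation to \<open>P\<^sub>0, \<dots>, P\<^sub>3\<close> and comparing coefficients in
  the basis \<open>P\<close> forces \<open>B\<^sub>0 = B\<^sub>1 = 0\<close>, \<open>C\<^sub>1 = (1 - Q) / 4\<close> and \<open>C\<^sub>2 = (1 - Q\<^sup>2) / 4\<close> in the three-term
  recurrence, with \<open>Q = q\<^sup>2\<close> or \<open>Q = q\<^sup>-\<^sup>2\<close> the two roots of a quadratic equation. These values
  determine \<open>u (T f)\<close> and \<open>u (z T f)\<close> in terms of \<open>u (z\<^sup>j f)\<close>, as one sees for \<open>f = P\<^sub>n\<close>, and the four
  equations follow from operator identities.

  Conversely, the first and the third equation say that \<open>T\<close> and \<open>\<S>\<^sub>q\<^sup>2\<close> turn into multiplication by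
  polynomials of degree 1 and 2 under \<open>u\<close>. By induction \<open>u (z\<^sup>j T f) = u (A\<^sub>j f)\<close> with
  \<open>deg A\<^sub>j \<le> j + 1\<close>, so \<open>T P\<^sub>n\<close> is orthogonal to all polynomials of degree less than \<open>n - 1\<close>.
\<close>

section \<open>Operator identities\<close>

locale askey_wilson =
  fixes q :: real
  assumes q_pos: "0 < q" and q_less_1: "q < 1"
begin

abbreviation D :: "complex poly \<Rightarrow> complex poly" where "D \<equiv> aw_Dq q"
abbreviation S :: "complex poly \<Rightarrow> complex poly" where "S \<equiv> aw_Sq q"
abbreviation \<alpha> :: complex where "\<alpha> \<equiv> complex_of_real (aw_alpha q)"

abbreviation \<alpha>\<^sub>2 :: complex where "\<alpha>\<^sub>2 \<equiv> 2 * \<alpha>\<^sup>2 - 1"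

text \<open>Division-free form: where the two shifted points coincide both sides vanish, so it holds
  at every \<open>\<sigma>\<close>, including those left out of the definition.\<close>

lemma poly_Dq:
  "poly (D p) (aw_x q \<sigma>) * (aw_x q (\<sigma> + 1/2) - aw_x q (\<sigma> - 1/2)) =
    poly p (aw_x q (\<sigma> + 1/2)) - poly p (aw_x q (\<sigma> - 1/2))"
  using theI'[OF aw_Dq_ex1[OF q_pos q_less_1, of p], folded aw_Dq_def, rule_format, of \<sigma>]
  by (cases "aw_x q (\<sigma> + 1/2) = aw_x q (\<sigma> - 1/2)") simp_all

lemma poly_Sq:
  "2 * poly (S p) (aw_x q \<sigma>) = poly p (aw_x q (\<sigma> + 1/2)) + poly p (aw_x q (\<sigma> - 1/2))"
  using theI'[OF aw_Sq_ex1[OF q_pos q_less_1, of p], folded aw_Sq_def, rule_format, of \<sigma>]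
  by (simp add: mult.commute)

text \<open>Every complex number is a lattice value, and away from 1 and -1 the shifted points
  differ, so the factor can be cancelled at all but two points.\<close>

lemma Dq_eqI:
  assumes "\<And>\<sigma>. poly r (aw_x q \<sigma>) * (aw_x q (\<sigma> + 1/2) - aw_x q (\<sigma> - 1/2)) =
    poly p (aw_x q (\<sigma> + 1/2)) - poly p (aw_x q (\<sigma> - 1/2))"
  shows "D p = r"
proof (rule poly_eq_off_finite[of "{1, -1}"])
  fix z :: complex assume z: "z \<notin> {1, -1}"
  obtain \<sigma> where \<sigma>: "aw_x q \<sigma> = z" using aw_x_surj[OF q_pos q_less_1] by blast
  have "aw_x q (\<sigma> + 1/2) \<noteq> aw_x q (\<sigma> - 1/2)"
    using z unfolding \<sigma>[symmetric] by (rule aw_x_shift_neq[OF q_pos q_less_1])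
  moreover have "poly (D p) z * (aw_x q (\<sigma> + 1/2) - aw_x q (\<sigma> - 1/2)) =
      poly r z * (aw_x q (\<sigma> + 1/2) - aw_x q (\<sigma> - 1/2))"
    unfolding \<sigma>[symmetric] poly_Dq assms ..
  ultimately show "poly (D p) z = poly r z" by simp
qed simp

lemma Sq_eqI:
  assumes "\<And>\<sigma>. 2 * poly r (aw_x q \<sigma>) = poly p (aw_x q (\<sigma> + 1/2)) + poly p (aw_x q (\<sigma> - 1/2))"
  shows "S p = r"
proof (rule poly_eq_off_finite[of "{}"])
  fix z :: complex
  obtain \<sigma> where \<sigma>: "aw_x q \<sigma> = z" using aw_x_surj[OF q_pos q_less_1] by blast
  have "2 * poly (S p) z = 2 * poly r z" unfolding \<sigma>[symmetric] poly_Sq assms ..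
  then show "poly (S p) z = poly r z" by simp
qed simp

section \<open>Linearity and product rules for \<open>D\<close> and \<open>S\<close>\<close>

lemma Dq_0 [simp]: "D 0 = 0"
  by (rule Dq_eqI) simp

lemma Sq_0 [simp]: "S 0 = 0"
  by (rule Sq_eqI) simp

lemma Dq_add [simp]: "D (f + g) = D f + D g"
  by (rule Dq_eqI) (simp add: distrib_right poly_Dq)

lemma Sq_add [simp]: "S (f + g) = S f + S g"
  by (rule Sq_eqI) (simp add: distrib_left poly_Sq)

lemma Dq_smult [simp]: "D (smult c f) = smult c (D f)"
  by (rule Dq_eqI) (simp only: poly_smult mult.assoc poly_Dq flip: right_diff_distrib)

lemma Sq_smult [simp]: "S (smult c f) = smult c (S f)"
  by (rule Sq_eqI) (simp add: mult.left_commute[of 2] poly_Sq distrib_left)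

lemma Dq_diff [simp]: "D (f - g) = D f - D g"
  using Dq_add[of "f - g" g] by (simp add: algebra_simps)

lemma Sq_diff [simp]: "S (f - g) = S f - S g"
  using Sq_add[of "f - g" g] by (simp add: algebra_simps)

text \<open>With shifted points \<open>y\<close>, \<open>w\<close>, twice y f(y) - w f(w) equals (y
  - w)(f(y) + f(w)) + (y + w)(f(y) - f(w)), and y + w is \<open>2 * \<alpha> * x\<close>. Together
  with \<open>Sq_pCons\<close> this evaluates \<open>D\<close> and \<open>S\<close> recursively on
  coefficients.\<close>

lemma Dq_pCons [simp]: "D (pCons c f) = S f + smult \<alpha> (pCons 0 (D f))"
proof (rule Dq_eqI)
  fix \<sigma>
  define x y w where "x = aw_x q \<sigma>" and "y = aw_x q (\<sigma> + 1/2)" and "w = aw_x q (\<sigma> - 1/2)"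
  have 1: "poly (D f) x * (y - w) = poly f y - poly f w"
    and 2: "2 * poly (S f) x = poly f y + poly f w" and 3: "y + w = 2 * \<alpha> * x"
    using poly_Dq[of f \<sigma>] poly_Sq[of f \<sigma>] aw_x_shift(1)[OF q_pos, of \<sigma>]
    by (simp_all add: x_def y_def w_def)
  have "poly (S f + smult \<alpha> (pCons 0 (D f))) x * (y - w) = y * poly f y - w * poly f w"
    using 1 2 3 by simp algebra
  then show "poly (S f + smult \<alpha> (pCons 0 (D f))) (aw_x q \<sigma>) * (aw_x q (\<sigma> + 1/2) - aw_x q (\<sigma> - 1/2))
      = poly (pCons c f) (aw_x q (\<sigma> + 1/2)) - poly (pCons c f) (aw_x q (\<sigma> - 1/2))"
    by (simp add: x_def y_def w_def)
qed

lemma Sq_pCons [simp]: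
  "S (pCons c f) = [:c:] + smult \<alpha> (pCons 0 (S f)) + smult (\<alpha>\<^sup>2 - 1) (pCons 0 (pCons 0 (D f)) - D f)"
  (is "_ = ?r")
proof (rule Sq_eqI)
  fix \<sigma>
  define x y w where "x = aw_x q \<sigma>" and "y = aw_x q (\<sigma> + 1/2)" and "w = aw_x q (\<sigma> - 1/2)"
  have 1: "poly (D f) x * (y - w) = poly f y - poly f w"
    and 2: "2 * poly (S f) x = poly f y + poly f w" and 3: "y + w = 2 * \<alpha> * x"
    and 4: "(y - w)\<^sup>2 = 4 * (\<alpha>\<^sup>2 - 1) * (x\<^sup>2 - 1)"
    using poly_Dq[of f \<sigma>] poly_Sq[of f \<sigma>] aw_x_shift[OF q_pos, of \<sigma>]
    by (simp_all add: x_def y_def w_def)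
  have "2 * poly ?r x = 2 * c + y * poly f y + w * poly f w"
    using 1 2 3 4 by simp algebra
  then show "2 * poly ?r (aw_x q \<sigma>)
      = poly (pCons c f) (aw_x q (\<sigma> + 1/2)) + poly (pCons c f) (aw_x q (\<sigma> - 1/2))"
    by (simp add: x_def y_def w_def)
qed

text \<open>Under the product rules, the difference of the two sides for \<open>pCons c f\<close> is
  the variable times the same difference for \<open>f\<close>, in both identities. Every composition
  is thereby reduced to \<open>D (D f)\<close> and \<open>S (D f)\<close>.\<close>

lemma Dq_Sq_and_Sq_Sq:
  "D (S f) = smult \<alpha> (S (D f)) + smult (\<alpha>\<^sup>2 - 1) (pCons 0 (D (D f))) \<and>
   S (S f) = f + smult (\<alpha>\<^sup>2 - 1)
     (smult \<alpha> (pCons 0 (pCons 0 (D (D f))) - D (D f)) + pCons 0 (S (D f)))"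
proof (induction f)
  case 0
  show ?case by simp
next
  case (pCons c f)
  have T: "poly (D (S f)) x = \<alpha> * poly (S (D f)) x + (\<alpha>\<^sup>2 - 1) * (x * poly (D (D f)) x)" for x
    using pCons by simp
  have S: "poly (S (S f)) x = poly f x + (\<alpha>\<^sup>2 - 1) *
      (\<alpha> * (x * (x * poly (D (D f)) x) - poly (D (D f)) x) + x * poly (S (D f)) x)" for x
    using pCons by simp
  let ?L = "D (S (pCons c f))" and ?R = "smult \<alpha> (S (D (pCons c f)))
    + smult (\<alpha>\<^sup>2 - 1) (pCons 0 (D (D (pCons c f))))"
  let ?L' = "S (S (pCons c f))" and ?R' = "pCons c f + smult (\<alpha>\<^sup>2 - 1)
    (smult \<alpha> (pCons 0 (pCons 0 (D (D (pCons c f)))) - D (D (pCons c f))) + pCons 0 (S (D (pCons c f))))"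
  have "poly ?L x - poly ?R x = x * (poly (D (S f)) x
      - (\<alpha> * poly (S (D f)) x + (\<alpha>\<^sup>2 - 1) * (x * poly (D (D f)) x)))" for x
    by (simp add: algebra_simps power2_eq_square)
  then have "poly ?L x = poly ?R x" for x
    unfolding T by (simp only: diff_self mult_zero_right right_minus_eq)
  moreover have "poly ?L' x - poly ?R' x = x * (poly (S (S f)) x - (poly f x + (\<alpha>\<^sup>2 - 1) *
      (\<alpha> * (x * (x * poly (D (D f)) x) - poly (D (D f)) x) + x * poly (S (D f)) x)))" for x
    by (simp add: algebra_simps power2_eq_square)
  then have "poly ?L' x = poly ?R' x" for x
    unfolding S by (simp only: diff_self mult_zero_right right_minus_eq)
  ultimately show ?case by (meson poly_eq_poly_eq_iff ext)
qed

text \<open>The numbers q^(1/2) and q^(-1/2) have product 1 and sum twice \<open>aw_alpha q\<close>,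
  so both are roots of one quadratic. This lets the two signs of \<open>s\<close> be treated
  together.\<close>

lemma two_alpha_mult_root:
  assumes "s \<in> {1, -1}" and "r = q powr (s / 2)"
  shows "2 * aw_alpha q * r = r\<^sup>2 + 1"
proof -
  define x y where "x = q powr (1/2)" and "y = q powr (- (1/2))"
  have "x * y = 1"
    using q_pos by (simp add: x_def y_def flip: powr_add)
  then have "(x + y) * x = x\<^sup>2 + 1" "(x + y) * y = y\<^sup>2 + 1" by algebra+
  moreover have "2 * aw_alpha q = x + y" by (simp add: aw_alpha_def x_def y_def)
  moreover have "r = x \<or> r = y" using assms by (auto simp: x_def y_def)
  ultimately show ?thesis by auto
qed

lemma powr_root:
  assumes "r = q powr (s / 2)"
  shows "q powr s = r\<^sup>2" "q powr (2 * s) = r ^ 4" "q powr (3 * s) = r ^ 6"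
    "q powr (4 * s) = r ^ 8" "q powr (5 * s / 2) = r ^ 5"
  using q_pos by (simp_all add: assms powr_power mult.commute)

lemma aw_alpha_gt_1: "aw_alpha q > 1"
proof -
  define t where "t = q powr (1/2)"
  have t: "0 < t" "t < 1" using q_pos q_less_1 using powr_less_mono2[of "1/2" q 1] by (auto simp: t_def)
  then have "(t - 1)\<^sup>2 > 0" by simp
  then have "1 < (t + 1 / t) / 2" using t by (simp add: field_simps power2_eq_square)
  then show ?thesis by (simp add: aw_alpha_def t_def powr_minus inverse_eq_divide)
qed

lemma alpha_nonzero: "\<alpha> \<noteq> 0" "\<alpha>\<^sub>2 \<noteq> 0"
proof -
  show "\<alpha> \<noteq> 0" using aw_alpha_gt_1 by simp
  have "(aw_alpha q)\<^sup>2 > 1" using aw_alpha_gt_1 by simp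
  then have "2 * (aw_alpha q)\<^sup>2 - 1 \<noteq> 0" by linarith
  then have "complex_of_real (2 * (aw_alpha q)\<^sup>2 - 1) \<noteq> 0" by (simp only: of_real_eq_0_iff) simp
  then show "\<alpha>\<^sub>2 \<noteq> 0" by simp
qed

text \<open>In terms of the averaging \<open>R\<close> over \<open>\<sigma> + 1\<close> and \<open>\<sigma> - 1\<close>, the
  operator \<open>D S / \<alpha>\<close> is the Askey-Wilson operator of base \<open>q\<^sup>2\<close>, whose \<open>\<alpha>\<close> is \<open>\<alpha>\<^sub>2\<close>.\<close>

definition R :: "complex poly \<Rightarrow> complex poly" where "R f = smult 2 (S (S f)) - f"

lemma Dq_Sq_pCons:
  "D (S (pCons c f)) = smult \<alpha> (R f) + smult \<alpha>\<^sub>2 (pCons 0 (D (S f)))"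
proof -
  have "poly (D (S (pCons c f))) x = poly (smult \<alpha> (R f) + smult \<alpha>\<^sub>2 (pCons 0 (D (S f)))) x" for x
    by (simp add: R_def Dq_Sq_and_Sq_Sq del: Dq_pCons) (simp add: Dq_Sq_and_Sq_Sq algebra_simps power2_eq_square)
  then show ?thesis by (meson poly_eq_poly_eq_iff ext)
qed

lemma R_pCons:
  "smult \<alpha> (R (pCons c f)) = [:\<alpha> * c:] + smult (\<alpha>\<^sub>2 * \<alpha>) (pCons 0 (R f))
    + smult (\<alpha>\<^sub>2\<^sup>2 - 1) (pCons 0 (pCons 0 (D (S f))) - D (S f))"
proof -
  have "poly (smult \<alpha> (R (pCons c f))) x = poly ([:\<alpha> * c:] + smult (\<alpha>\<^sub>2 * \<alpha>) (pCons 0 (R f))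
    + smult (\<alpha>\<^sub>2\<^sup>2 - 1) (pCons 0 (pCons 0 (D (S f))) - D (S f))) x" for x
    by (simp add: R_def del: Sq_pCons Dq_pCons) (simp add: Dq_Sq_and_Sq_Sq algebra_simps power2_eq_square)
  then show ?thesis by (meson poly_eq_poly_eq_iff ext)
qed

text \<open>Eliminating \<open>R\<close> between the two preceding product rules leaves a relation
  between \<open>D S\<close> and multiplication by the variable alone, which can be tested on
  \<open>P\<close> when only \<open>D S\<close> is known there.\<close>

lemma Dq_Sq_pCons_pCons:
  "D (S (pCons 0 (pCons 0 f))) - smult (2 * \<alpha>\<^sub>2) (pCons 0 (D (S (pCons 0 f))))
    + pCons 0 (pCons 0 (D (S f))) = smult (1 - \<alpha>\<^sub>2\<^sup>2) (D (S f))"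
proof -
  have "poly (D (S (pCons 0 (pCons 0 f))) - smult (2 * \<alpha>\<^sub>2) (pCons 0 (D (S (pCons 0 f))))
    + pCons 0 (pCons 0 (D (S f)))) x = poly (smult (1 - \<alpha>\<^sub>2\<^sup>2) (D (S f))) x" for x
    unfolding Dq_Sq_pCons R_pCons by (simp add: Dq_Sq_pCons algebra_simps power2_eq_square)
  then show ?thesis by (meson poly_eq_poly_eq_iff ext)
qed

text \<open>Solving the two formulas in \<open>Dq_Sq_and_Sq_Sq\<close> for \<open>D D\<close> and \<open>S D\<close>:
  their determinant is the weight \<open>z\<^sup>2 - \<alpha>\<^sup>2\<close>.\<close>

lemma weighted_Dq_Dq:
  "smult (2 * (\<alpha>\<^sup>2 - 1)) (pCons 0 (pCons 0 (D (D f))) - smult (\<alpha>\<^sup>2) (D (D f))) =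
    smult \<alpha> (R f - f) - smult (2 * (\<alpha>\<^sup>2 - 1)) (pCons 0 (D (S f)))" (is "?l = ?r")
proof -
  have "poly ?l x = poly ?r x" for x
    by (simp add: R_def Dq_Sq_and_Sq_Sq algebra_simps power2_eq_square)
  then show ?thesis by (meson poly_eq_poly_eq_iff ext)
qed

lemma weighted_Sq_Dq:
  "smult 2 (pCons 0 (pCons 0 (S (D f))) - smult (\<alpha>\<^sup>2) (S (D f))) =
    smult (2 * \<alpha>) (pCons 0 (pCons 0 (D (S f))) - D (S f)) - pCons 0 (R f - f)" (is "?l = ?r")
proof -
  have "poly ?l x = poly ?r x" for x
    by (simp add: R_def Dq_Sq_and_Sq_Sq algebra_simps power2_eq_square)
  then show ?thesis by (meson poly_eq_poly_eq_iff ext)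
qed

text \<open>Joint induction, because each product rule involves both operators. The alternative
  \<open>D p = 0\<close> covers the constants.\<close>

lemma degree_Dq_and_Sq:
  "(D p = 0 \<or> degree (D p) < degree p) \<and> degree (S p) \<le> degree p"
proof (induction p)
  case 0
  show ?case by simp
next
  case (pCons c p)
  show ?case
  proof (cases "p = 0")
    case False
    have 1: "degree (pCons 0 (D p)) \<le> degree p" and 2: "degree (pCons 0 (pCons 0 (D p)) - D p) \<le> Suc (degree p)"
      and 3: "degree (pCons 0 (S p)) \<le> Suc (degree p)"
      using pCons by (auto intro!: degree_diff_le)
    have "degree (S p + smult \<alpha> (pCons 0 (D p))) \<le> degree p"
      using pCons 1 by (intro degree_add_le) (auto intro: order.trans[OF degree_smult_le])
    moreover have "degree (S (pCons c p)) \<le> Suc (degree p)"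
      unfolding Sq_pCons using 2 3 by (intro degree_add_le) (auto intro: order.trans[OF degree_smult_le])
    ultimately show ?thesis using False by simp
  qed simp
qed

lemma degree_Dq_Sq: "D (S p) = 0 \<or> degree (D (S p)) < degree p"
  using degree_Dq_and_Sq[of p] degree_Dq_and_Sq[of "S p"] by auto

end


section \<open>Monic orthogonal polynomial sequences\<close>

lemma pCons_0_linear:
  fixes f g :: "'a::comm_ring_1 poly"
  shows "pCons 0 (f + g) = pCons 0 f + pCons 0 g" "pCons 0 (f - g) = pCons 0 f - pCons 0 g"
    "pCons 0 (smult c f) = smult c (pCons 0 f)"
  by simp_all

lemma in_dualI:
  assumes "\<And>f g. w (f + g) = w f + w g" and "\<And>c f. w (smult c f) = c * w f"
  shows "in_dual w"
  unfolding in_dual_def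
  by (intro Vector_Spaces.linear.intro module_hom.intro module_hom_axioms.intro
      vector_space.intro)
    (simp_all add: assms module_def vector_space_def smult_add_right smult_add_left algebra_simps)

lemma in_dual_add: "in_dual w \<Longrightarrow> w (f + g) = w f + w g"
  unfolding in_dual_def Vector_Spaces.linear_def by (blast intro: module_hom.add)

lemma in_dual_smult: "in_dual w \<Longrightarrow> w (smult c f) = c * w f"
  unfolding in_dual_def Vector_Spaces.linear_def by (blast intro: module_hom.scale)

text \<open>Subtracting a multiple of \<open>P (degree f)\<close> removes the leading term, so a
  monic sequence with one member in each degree spans all polynomials.\<close>

lemma in_dual_eqI:
  fixes P :: "nat \<Rightarrow> complex poly"
  assumes "in_dual v" "in_dual w"
    and deg: "\<And>n. degree (P n) = n" and lead: "\<And>n. lead_coeff (P n) = 1"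
    and eq: "\<And>n. v (P n) = w (P n)"
  shows "v f = w f"
proof (induction "degree f" arbitrary: f rule: less_induct)
  case less
  define g where "g = f - smult (lead_coeff f) (P (degree f))"
  have f: "f = g + smult (lead_coeff f) (P (degree f))"
    by (simp add: g_def)
  have "g = 0 \<or> degree g < degree f"
  proof (cases "degree f = 0")
    case True
    then have "f = [:coeff f 0:]" "P 0 = [:1:]"
      using deg[of 0] lead[of 0] by (auto elim!: degree_eq_zeroE)
    then show ?thesis using True unfolding g_def by (metis diff_self mult_1_right smult_pCons smult_0_right)
  next
    case False
    have "degree g < degree f"
    proof (rule degree_lessI)
      show "g \<noteq> 0 \<or> degree f > 0" using False by simp
      show "\<forall>k\<ge>degree f. coeff g k = 0"
        using deg lead[of "degree f"] unfolding g_def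
        by (auto simp: coeff_eq_0 le_less)
    qed
    then show ?thesis ..
  qed
  then have "v g = w g"
  proof
    assume "g = 0"
    then show ?thesis
      using in_dual_smult[OF assms(1), of 0 0] in_dual_smult[OF assms(2), of 0 0] by simp
  qed (rule less)
  then show ?case
    unfolding f[symmetric] by (subst (1 2) f)
      (simp only: in_dual_add[OF assms(1)] in_dual_add[OF assms(2)]
        in_dual_smult[OF assms(1)] in_dual_smult[OF assms(2)] eq)
qed

locale monic_OPS =
  fixes u :: "complex poly \<Rightarrow> complex" and P :: "nat \<Rightarrow> complex poly" and h :: "nat \<Rightarrow> complex"
  assumes dual: "in_dual u"
    and degree_P [simp]: "degree (P n) = n"
    and coeff_P [simp]: "coeff (P n) n = 1"
    and h_nonzero [simp]: "h n \<noteq> 0"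
    and ortho: "u (P j * P n) = (if j = n then h n else 0)"
begin

lemmas u_add [simp] = in_dual_add[OF dual]
lemmas u_smult [simp] = in_dual_smult[OF dual]

lemma u_0 [simp]: "u 0 = 0"
  using u_smult[of 0 0] by simp

lemma u_diff [simp]: "u (f - g) = u f - u g"
  using u_add[of "f - g" g] by simp

lemma P_nonzero [simp]: "P n \<noteq> 0"
  using coeff_P[of n] by (metis coeff_0 zero_neq_one)

lemma P_0: "P 0 = 1"
  using degree_P[of 0] coeff_P[of 0] by (metis degree_eq_zeroE coeff_pCons_0 one_pCons)

lemma u_P: "u (P n) = (if n = 0 then h 0 else 0)"
  using ortho[of 0 n] by (simp add: P_0)

text \<open>Expanding \<open>p\<close> in the basis \<open>P\<close>, only the term of index
  \<open>n\<close> survives; for smaller degree this is orthogonality to all lower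
  polynomials.\<close>

lemma u_P_mult:
  assumes "degree p \<le> n"
  shows "u (P n * p) = coeff p n * h n"
  using assms
proof (induction "degree p" arbitrary: p rule: less_induct)
  case less
  define g where "g = p - smult (lead_coeff p) (P (degree p))"
  have p: "p = g + smult (lead_coeff p) (P (degree p))"
    by (simp add: g_def)
  have u: "u (P n * p) = u (P n * g) + lead_coeff p * u (P n * P (degree p))"
    by (subst p) (simp add: distrib_left)
  show ?case
  proof (cases "degree p = 0")
    case True
    then have "g = 0"
      unfolding g_def by (auto elim!: degree_eq_zeroE simp: P_0)
    then show ?thesis using True u less.prems
      by (cases n) (auto simp: ortho coeff_eq_0)
  next
    case False
    have g: "degree g < degree p"
    proof (rule degree_lessI)
      show "g \<noteq> 0 \<or> degree p > 0" using False by simp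
      show "\<forall>k\<ge>degree p. coeff g k = 0"
        unfolding g_def by (auto simp: coeff_eq_0 le_less)
    qed
    then have "u (P n * g) = 0"
      using less by (simp add: coeff_eq_0)
    with u less.prems show ?thesis
      by (cases "degree p = n") (auto simp: ortho coeff_eq_0)
  qed
qed

lemma eq_0I:
  assumes "\<And>j. u (P j * p) = 0"
  shows "p = 0"
  using u_P_mult[of p "degree p"] assms[of "degree p"] by simp

lemma three_term_recurrence:
  obtains B C :: "nat \<Rightarrow> complex" where "C 0 = 0" "\<And>n. C (Suc n) \<noteq> 0"
    "\<And>n. pCons 0 (P n) = P (Suc n) + smult (B n) (P n) + smult (C n) (P (n - 1))"
proof
  let ?B = "\<lambda>n. u (pCons 0 (P n) * P n) / h n"
  \<comment> \<open>The guard matters because \<open>n - 1\<close> is 0 at \<open>n = 0\<close>: the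
    last term of the recurrence has to vanish there.\<close>
  let ?C = "\<lambda>n. if n = 0 then 0 else h n / h (n - 1)"
  show "?C 0 = 0" "?C (Suc n) \<noteq> 0" for n by simp_all
  fix n
  have deg: "degree (pCons 0 (P j)) = Suc j" and co: "coeff (pCons 0 (P j)) (Suc j) = 1" for j
    using coeff_P[of j] by (auto simp: degree_pCons_eq_if)
  \<comment> \<open>Multiplication by the variable is symmetric under \<open>u\<close>. For j < n it
    is moved to \<open>P j\<close>, whose degree then stays at most \<open>n\<close>.\<close>
  have swap: "P j * pCons 0 (P n) = P n * pCons 0 (P j)" for j
    by (simp add: mult.commute)
  have "pCons 0 (P n) - (P (Suc n) + smult (?B n) (P n) + smult (?C n) (P (n - 1))) = 0"
  proof (rule eq_0I)
    fix j
    have "u (P j * pCons 0 (P n)) =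
      (if j = Suc n then h j else if j = n then ?B n * h n else if Suc j = n then h n else 0)"
    proof -
      consider "j > Suc n" | "j = Suc n" | "j = n" | "Suc j = n" | "Suc j < n" by linarith
      then show ?thesis
      proof cases
        case 1 then show ?thesis using u_P_mult[of "pCons 0 (P n)" j] deg[of n] by (simp add: coeff_eq_0)
      next
        case 2 then show ?thesis using u_P_mult[of "pCons 0 (P n)" j] deg[of n] co[of n] by simp
      next
        case 3 then show ?thesis by (simp add: mult.commute)
      next
        case 4 then show ?thesis using u_P_mult[of "pCons 0 (P j)" n] deg[of j] co[of j] unfolding swap by auto
      next
        case 5 then show ?thesis using u_P_mult[of "pCons 0 (P j)" n] deg[of j] unfolding swap by (auto simp: coeff_eq_0)
      qed
    qed
    then show "u (P j * (pCons 0 (P n) - (P (Suc n) + smult (?B n) (P n) + smult (?C n) (P (n - 1))))) = 0"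
      by (auto simp: right_diff_distrib distrib_left ortho simp del: mult_pCons_right)
  qed
  then show "pCons 0 (P n) = P (Suc n) + smult (?B n) (P n) + smult (?C n) (P (n - 1))"
    by (simp only: right_minus_eq)
qed

end


section \<open>From the lowering relation to the functional equations\<close>

locale askey_wilson_OPS = askey_wilson q + monic_OPS u P h
  for q :: real and u P h
begin

lemma lowering_recurrence_coefficients:
  assumes lower: "\<And>n. D (S (P n)) = smult (k n) (if n = 0 then 0 else P (n - 1))"
    and C0: "C 0 = 0" and C: "\<And>n. C (Suc n) \<noteq> 0"
    and rec: "\<And>n. pCons 0 (P n) = P (Suc n) + smult (B n) (P n) + smult (C n) (P (n - 1))"
  obtains Q where "Q\<^sup>2 + (2 - 4 * \<alpha>\<^sub>2\<^sup>2) * Q + 1 = 0"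
    "B 0 = 0" "B 1 = 0" "C 1 = (1 - Q) / 4" "C 2 = (1 - Q\<^sup>2) / 4"
    "k 1 = \<alpha>" "k 2 = 2 * \<alpha>\<^sub>2 * \<alpha>"
proof
  define X :: "complex poly \<Rightarrow> complex poly" where "X = pCons 0"
  define T where "T f = D (S f)" for f
  define a where "a = \<alpha>\<^sub>2"
  have X: "X (f + g) = X f + X g" "X (smult c f) = smult c (X f)" "X 0 = 0" for f g c
    by (simp_all add: X_def)
  have T: "T (f + g) = T f + T g" "T (smult c f) = smult c (T f)" "T 0 = 0" for f g c
    by (simp_all add: T_def)
  have TP: "T (P 0) = 0" "T (P (Suc n)) = smult (k (Suc n)) (P n)" for n
    using lower[of 0] lower[of "Suc n"] by (simp_all add: T_def)
  have XP: "X (P 0) = P (Suc 0) + smult (B 0) (P 0)"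
    "X (P (Suc n)) = P (Suc (Suc n)) + smult (B (Suc n)) (P (Suc n)) + smult (C (Suc n)) (P n)" for n
    using rec[of 0] rec[of "Suc n"] by (simp_all add: X_def C0)
  have L: "u (P j * T (X (X (P n)))) - 2 * a * u (P j * X (T (X (P n)))) + u (P j * X (X (T (P n))))
      = (1 - a\<^sup>2) * u (P j * T (P n))" for j n
    using arg_cong[OF Dq_Sq_pCons_pCons[of "P n"], of "\<lambda>p. u (P j * p)"]
    unfolding X_def[symmetric] T_def[symmetric] a_def
    by (simp only: distrib_left right_diff_distrib mult_smult_right u_add u_diff u_smult)
  note expand = X T TP XP distrib_left ortho mult_smult_right smult_add_right
  have "P 1 = pCons 0 (P 0) - smult (B 0) (P 0)"
    unfolding rec by (simp add: C0)
  then have "P 1 = [:- B 0, 1:]"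
    by (simp add: P_0 one_pCons)
  then have k1: "k 1 = \<alpha>"
    using lower[of 1] by (simp add: P_0 one_pCons)
  \<comment> \<open>The digit in \<open>E0a\<close> to \<open>E3\<close> is \<open>n\<close>.
    Pairing with index n + 1 determines \<open>k\<close>, with n the \<open>B\<close>, with n - 1
    the \<open>C\<close>; the pairings of \<open>E2c\<close> and \<open>E3\<close>, with n - 2 and n
    - 3, are the remaining constraints.\<close>
  have E0a: "k 2 = 2 * a * k 1"
    using L[of 1 0] by (simp add: expand numeral_2_eq_2)
  have E0b: "(B 1 + B 0) * k 1 = 2 * a * B 0 * k 1"
    using L[of 0 0] by (simp add: expand mult.assoc flip: distrib_right)
  show "k 1 = \<alpha>" "k 2 = 2 * \<alpha>\<^sub>2 * \<alpha>" using k1 E0a by (simp_all add: a_def)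
  have E1a: "h 2 * (k 3 - 2 * a * k 2 + k 1) = 0"
    using L[of 2 1] by (simp add: expand numeral_2_eq_2 numeral_3_eq_3 algebra_simps)
  have E1b: "h 1 * ((B 2 + B 1) * k 2 - 2 * a * (k 2 * B 1 + B 1 * k 1) + k 1 * (B 1 + B 0)) = 0"
    using L[of 1 1] by (simp add: expand numeral_2_eq_2 numeral_3_eq_3 algebra_simps)
  have E1c: "h 0 * ((C 2 + (B 1)\<^sup>2 + C 1) * k 1 - 2 * a * (k 2 * C 1 + B 1 * k 1 * B 0)
      + k 1 * ((B 0)\<^sup>2 + C 1) - (1 - a\<^sup>2) * k 1) = 0"
    using L[of 0 1] by (simp add: expand numeral_2_eq_2 numeral_3_eq_3 algebra_simps)
  have E2b: "h 1 * ((C 3 + (B 2)\<^sup>2 + C 2) * k 2 - 2 * a * (k 3 * C 2 + B 2 * k 2 * B 1 + C 2 * k 1)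
      + k 2 * (C 2 + (B 1)\<^sup>2 + C 1) - (1 - a\<^sup>2) * k 2) = 0"
    using L[of 1 2] by (simp add: expand numeral_2_eq_2 numeral_3_eq_3 algebra_simps)
  have E2c: "h 0 * (C 2 * (B 2 + B 1) * k 1 - 2 * a * (B 2 * k 2 * C 1 + C 2 * k 1 * B 0)
      + k 2 * C 1 * (B 1 + B 0)) = 0"
    using L[of 0 2] by (simp add: expand numeral_2_eq_2 numeral_3_eq_3 algebra_simps)
  have E3: "h 0 * (C 3 * C 2 * k 1 - 2 * a * C 3 * k 2 * C 1 + k 3 * C 2 * C 1) = 0"
    using L[of 0 3] by (simp add: expand numeral_2_eq_2 numeral_3_eq_3 algebra_simps)
  have nz: "k 1 \<noteq> 0" "a \<noteq> 0" "C 1 \<noteq> 0" "C 2 \<noteq> 0"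
    using alpha_nonzero C[of 0] C[of 1] k1 by (simp_all add: a_def numeral_2_eq_2)
  have a1: "4 * a\<^sup>2 - 1 \<noteq> 0" "2 * a + 1 \<noteq> 0" "a - 1 \<noteq> 0" "1 - a\<^sup>2 \<noteq> 0"
  proof -
    define x where "x = 2 * (aw_alpha q)\<^sup>2 - 1"
    have "(aw_alpha q)\<^sup>2 > 1" using aw_alpha_gt_1 by simp
    then have x: "x > 1" by (simp add: x_def)
    then have "x\<^sup>2 > 1" by simp
    then have "4 * x\<^sup>2 - 1 \<noteq> 0" "2 * x + 1 \<noteq> 0" "x - 1 \<noteq> 0" "1 - x\<^sup>2 \<noteq> 0"
      using x by linarith+
    then have "complex_of_real (4 * x\<^sup>2 - 1) \<noteq> 0" "complex_of_real (2 * x + 1) \<noteq> 0"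
      "complex_of_real (x - 1) \<noteq> 0" "complex_of_real (1 - x\<^sup>2) \<noteq> 0"
      unfolding of_real_eq_0_iff .
    moreover have "a = of_real x" by (simp add: a_def x_def)
    ultimately show "4 * a\<^sup>2 - 1 \<noteq> 0" "2 * a + 1 \<noteq> 0" "a - 1 \<noteq> 0" "1 - a\<^sup>2 \<noteq> 0"
      by simp_all
  qed
  have k3: "k 3 = (4 * a\<^sup>2 - 1) * k 1"
  proof -
    have "k 3 - 2 * a * k 2 + k 1 = 0" using E1a by simp
    then show ?thesis unfolding E0a by algebra
  qed
  have B1: "B 1 = (2 * a - 1) * B 0"
  proof -
    have "k 1 * (B 1 - (2 * a - 1) * B 0) = 0" using E0b by algebra
    then show ?thesis using nz by simp
  qed
  have B2: "B 2 = (4 * a\<^sup>2 - 2 * a - 1) * B 0"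
  proof -
    have "(B 2 + B 1) * k 2 - 2 * a * (k 2 * B 1 + B 1 * k 1) + k 1 * (B 1 + B 0) = 0"
      using E1b by simp
    then have "(k 1 * a * 2) * (B 2 - (4 * a\<^sup>2 - 2 * a - 1) * B 0) = 0"
      unfolding E0a B1 by algebra
    then show ?thesis using nz by simp
  qed
  have C2: "C 2 = (4 * a\<^sup>2 - 2) * C 1 + (1 - a\<^sup>2) + (2 * a - 2) * (B 0)\<^sup>2"
  proof -
    have "(C 2 + (B 1)\<^sup>2 + C 1) * k 1 - 2 * a * (k 2 * C 1 + B 1 * k 1 * B 0)
      + k 1 * ((B 0)\<^sup>2 + C 1) - (1 - a\<^sup>2) * k 1 = 0"
      using E1c by simp
    then have "k 1 * (C 2 - ((4 * a\<^sup>2 - 2) * C 1 + (1 - a\<^sup>2) + (2 * a - 2) * (B 0)\<^sup>2)) = 0"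
      unfolding E0a B1 by algebra
    then show ?thesis using nz by simp
  qed
  have C3: "C 3 = (4 * a\<^sup>2 - 2) * C 2 - C 1 + (1 - a\<^sup>2) + (2 * a - 2) * (B 0)\<^sup>2"
  proof -
    have "(C 3 + (B 2)\<^sup>2 + C 2) * k 2 - 2 * a * (k 3 * C 2 + B 2 * k 2 * B 1 + C 2 * k 1)
      + k 2 * (C 2 + (B 1)\<^sup>2 + C 1) - (1 - a\<^sup>2) * k 2 = 0"
      using E2b by simp
    then have "(k 1 * a * 2) * (C 3 - ((4 * a\<^sup>2 - 2) * C 2 - C 1 + (1 - a\<^sup>2) + (2 * a - 2) * (B 0)\<^sup>2)) = 0"
      unfolding E0a k3 B1 B2 by algebra
    then show ?thesis using nz by simp
  qed
  \<comment> \<open>The inhomogeneous terms of \<open>C2\<close> and \<open>C3\<close> agree, so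
    eliminating them makes the relation homogeneous.\<close>
  have C3': "C 3 = (4 * a\<^sup>2 - 1) * (C 2 - C 1)"
    using C2 C3 by algebra
  have quad: "(C 2)\<^sup>2 - 4 * a\<^sup>2 * C 1 * C 2 + 4 * a\<^sup>2 * (C 1)\<^sup>2 = 0"
  proof -
    have "C 3 * C 2 * k 1 - 2 * a * C 3 * k 2 * C 1 + k 3 * C 2 * C 1 = 0"
      using E3 by simp
    then have "(k 1 * (4 * a\<^sup>2 - 1)) * ((C 2)\<^sup>2 - 4 * a\<^sup>2 * C 1 * C 2 + 4 * a\<^sup>2 * (C 1)\<^sup>2) = 0"
      unfolding E0a k3 C3' by algebra
    then show ?thesis using nz a1 by simp
  qed
  \<comment> \<open>\<open>E2c\<close> factors as \<open>B 0\<close> times a quantity whose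
    vanishing would contradict \<open>quad\<close>.\<close>
  show b: "B 0 = 0"
  proof -
    have "C 2 * (B 2 + B 1) * k 1 - 2 * a * (B 2 * k 2 * C 1 + C 2 * k 1 * B 0)
      + k 2 * C 1 * (B 1 + B 0) = 0"
      using E2c by simp
    then have "(k 1 * 2 * ((2 * a + 1) * (a - 1))) * ((C 2 - 4 * a\<^sup>2 * C 1) * B 0) = 0"
      unfolding E0a B1 B2 by algebra
    moreover have "C 2 \<noteq> 4 * a\<^sup>2 * C 1"
    proof
      assume "C 2 = 4 * a\<^sup>2 * C 1"
      with quad have "(a * C 1)\<^sup>2 = 0" by algebra
      with nz show False by simp
    qed
    ultimately show ?thesis using nz a1 by simp
  qed
  show "B 1 = 0" using B1 b by simp
  \<comment> \<open>Dividing the homogeneous equation \<open>quad\<close> by the square of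
    \<open>C 1\<close> gives a quadratic for the ratio \<open>C 2 / C 1\<close>; the shift by 1
    makes it reciprocal.\<close>
  define Q where "Q = C 2 / C 1 - 1"
  have C2': "C 2 = C 1 * (1 + Q)" using nz by (simp add: Q_def)
  show Q: "(C 2 / C 1 - 1)\<^sup>2 + (2 - 4 * \<alpha>\<^sub>2\<^sup>2) * (C 2 / C 1 - 1) + 1 = 0"
  proof -
    have "(C 1)\<^sup>2 * (Q\<^sup>2 + (2 - 4 * a\<^sup>2) * Q + 1) = 0"
      using quad unfolding C2' by algebra
    then show ?thesis using nz unfolding Q_def a_def by simp
  qed
  then have Q': "Q\<^sup>2 + (2 - 4 * a\<^sup>2) * Q + 1 = 0" by (simp add: Q_def a_def)
  have "Q \<noteq> 1"
  proof
    assume "Q = 1"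
    with Q' have "4 * (1 - a\<^sup>2) = 0" by algebra
    then show False using a1 by simp
  qed
  \<comment> \<open>Multiply \<open>C2\<close> by \<open>Q\<close> and replace
    \<open>4 * a\<^sup>2 * Q\<close> by (1 + Q)^2, using the quadratic.\<close>
  moreover have "(Q - 1) * (4 * C 1 - (1 - Q)) = 0"
    using Q' C2 C2' b by algebra
  ultimately have "C 1 * 4 = 1 - Q" by (simp add: mult.commute)
  then have "C 1 = (1 - Q) / 4" by (simp add: eq_divide_eq)
  then show "C 1 = (1 - (C 2 / C 1 - 1)) / 4" unfolding Q_def .
  have "C 2 * 4 = 1 - Q\<^sup>2"
    using C2' \<open>C 1 * 4 = 1 - Q\<close> by algebra
  then have "C 2 = (1 - Q\<^sup>2) / 4" by (simp add: eq_divide_eq)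
  then show "C 2 = (1 - (C 2 / C 1 - 1)\<^sup>2) / 4" unfolding Q_def .
qed

text \<open>Here \<open>r\<close> stands for q^(s/2), so Q is \<open>r ^ 4\<close>. Only
  \<open>N0\<close> and \<open>N1\<close> are checked on the basis \<open>P\<close>; everything else
  is linear algebra on values of \<open>u\<close>, using the operator identities.\<close>

lemma functional_equations:
  assumes lower: "\<And>n. D (S (P n)) = smult (k n) (if n = 0 then 0 else P (n - 1))"
    and C0: "C 0 = 0" and C: "\<And>n. C (Suc n) \<noteq> 0"
    and rec: "\<And>n. pCons 0 (P n) = P (Suc n) + smult (B n) (P n) + smult (C n) (P (n - 1))"
    and B: "B 0 = 0" "B 1 = 0" and C1: "4 * C 1 = 1 - r ^ 4" and C2: "4 * C 2 = 1 - r ^ 8"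
    and k: "k 1 = \<alpha>" "k 2 = 2 * \<alpha>\<^sub>2 * \<alpha>"
    and r: "r \<noteq> 0" "2 * \<alpha> * r = r\<^sup>2 + 1"
  shows "r * (r\<^sup>2 - 1) * - u (D (S f)) = 2 * u (pCons 0 f)"
    and "4 * (\<alpha>\<^sup>2 - 1) * r ^ 5 * (u (pCons 0 (pCons 0 (D (D f)))) - \<alpha>\<^sup>2 * u (D (D f)))
      = - 4 * u (pCons 0 (pCons 0 f)) + (1 - r ^ 4) * u f"
    and "4 * r ^ 4 * u (S (S f)) = - 4 * u (pCons 0 (pCons 0 f)) + (1 + 3 * r ^ 4) * u f"
    and "2 * r ^ 6 * (1 - r\<^sup>2) * - (u (pCons 0 (pCons 0 (S (D f)))) - \<alpha>\<^sup>2 * u (S (D f)))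
      = - 4 * u (pCons 0 (pCons 0 (pCons 0 f))) + (r ^ 8 + r ^ 4 + 2) * u (pCons 0 f)"
proof -
  have in1: "in_dual (\<lambda>f. c * u (D (S f)))" "in_dual (\<lambda>f. c * u (pCons 0 (D (S f))))"
    "in_dual (\<lambda>f. c * u (pCons 0 f))"
    "in_dual (\<lambda>f. c * u (pCons 0 (pCons 0 f)) - d * u f)" for c d
    by (rule in_dualI; simp add: pCons_0_linear algebra_simps del: add_pCons diff_pCons smult_pCons)+
  define a where "a = \<alpha>"
  define b where "b = \<alpha>\<^sub>2"
  have nz: "r \<noteq> 0" "a \<noteq> 0" "1 - r ^ 4 \<noteq> 0"
    using r(1) alpha_nonzero(1) C[of 0] C1 by (auto simp: a_def)
  have a: "2 * a * r = r\<^sup>2 + 1"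
    using r by (simp add: a_def)
  have b2: "b = 2 * a\<^sup>2 - 1" by (simp add: a_def b_def)
  then have b: "2 * b * r\<^sup>2 = r ^ 4 + 1"
    using a by algebra
  have u1: "u (pCons 0 (P n)) = (if n = 1 then C 1 * h 0 else 0)" for n
  proof -
    have "u (pCons 0 (P n)) = B n * u (P n) + C n * u (P (n - 1))"
      unfolding rec by (simp add: u_P)
    then show ?thesis using B C0 by (cases n) (auto simp: u_P)
  qed
  have u2: "u (pCons 0 (pCons 0 (P n))) = (if n = 0 then C 1 * h 0 else if n = 2 then C 2 * C 1 * h 0 else 0)" for n
  proof -
    have "u (pCons 0 (pCons 0 (P n))) = u (pCons 0 (P (Suc n)))
        + B n * u (pCons 0 (P n)) + C n * u (pCons 0 (P (n - 1)))"
      by (subst rec) (simp only: pCons_0_linear u_add u_smult)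
    then show ?thesis using B C0 by (cases n) (auto simp: u1 numeral_2_eq_2)
  qed
  \<comment> \<open>On \<open>P n\<close> both sides vanish except at n = 1, where
    \<open>k 1\<close> and \<open>C 1\<close> give the constant.\<close>
  have N0: "r * (1 - r\<^sup>2) * u (D (S f)) = 2 * u (pCons 0 f)" for f
  proof (rule in_dual_eqI[OF in1(1,3), of P])
    fix n
    show "r * (1 - r\<^sup>2) * u (D (S (P n))) = 2 * u (pCons 0 (P n))"
    proof (cases "n = 1")
      case True
      then have "u (D (S (P n))) = a * h 0" "u (pCons 0 (P n)) = C 1 * h 0"
        using k(1) by (simp_all add: lower u_P u1 a_def)
      then show ?thesis using a C1 by algebra
    qed (simp add: lower u_P u1)
  qed simp_all
  \<comment> \<open>Only n = 0 and n = 2 matter: the value of \<open>C 1\<close> makes the right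
    side vanish at 0, and \<open>k 2\<close> and \<open>C 2\<close> give equality at 2.\<close>
  have N1: "2 * r ^ 3 * (1 - r\<^sup>2) * u (pCons 0 (D (S f))) = 4 * u (pCons 0 (pCons 0 f)) - (1 - r ^ 4) * u f" for f
  proof (rule in_dual_eqI[OF in1(2,4), of P])
    fix n
    have "u (pCons 0 (D (S (P n)))) = (if n = 0 then 0 else k n * u (pCons 0 (P (n - 1))))"
      unfolding lower by (simp only: pCons_0_linear u_smult) simp
    moreover have "n - 1 = 1 \<longleftrightarrow> n = 2" by linarith
    ultimately have N: "u (pCons 0 (D (S (P n)))) = (if n = 2 then 2 * b * a * (C 1 * h 0) else 0)"
      using k by (auto simp: u1 a_def b_def)
    consider "n = 0" | "n = 2" | "n \<noteq> 0" "n \<noteq> 2" by blast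
    then show "2 * r ^ 3 * (1 - r\<^sup>2) * u (pCons 0 (D (S (P n)))) =
        4 * u (pCons 0 (pCons 0 (P n))) - (1 - r ^ 4) * u (P n)"
    proof cases
      case 1
      then have "u (pCons 0 (D (S (P n)))) = 0" "u (pCons 0 (pCons 0 (P n))) = C 1 * h 0" "u (P n) = h 0"
        unfolding N u2 u_P by simp_all
      then show ?thesis using C1 by algebra
    next
      case 2
      then have "u (pCons 0 (D (S (P n)))) = 2 * b * a * (C 1 * h 0)"
        "u (pCons 0 (pCons 0 (P n))) = C 2 * C 1 * h 0" "u (P n) = 0"
        unfolding N u2 u_P by simp_all
      moreover have "2 * r ^ 3 * (1 - r\<^sup>2) * (2 * b * a) = 4 * C 2"
      proof -
        have "2 * r ^ 3 * (1 - r\<^sup>2) * (2 * b * a) = (2 * b * r\<^sup>2) * (2 * a * r) * (1 - r\<^sup>2)"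
          by algebra
        also have "\<dots> = 1 - r ^ 8" unfolding a b by algebra
        finally show ?thesis using C2 by simp
      qed
      ultimately show ?thesis by algebra
    next
      case 3
      then show ?thesis unfolding N u2 u_P by simp
    qed
  qed simp_all
  define M0 M1 M2 M3 where "M0 = u f" and "M1 = u (pCons 0 f)"
    and "M2 = u (pCons 0 (pCons 0 f))" and "M3 = u (pCons 0 (pCons 0 (pCons 0 f)))"
  note M = M0_def[symmetric] M1_def[symmetric] M2_def[symmetric] M3_def[symmetric]
  \<comment> \<open>\<open>T\<close>, \<open>X\<close>, \<open>Y\<close> carry 0, 1, 2 factors of
    the variable outside \<open>D S\<close>, and their digit counts the factors inside; for
    \<open>R0\<close>, \<open>R1\<close> the digit counts those outside. The aim is to express all
    of them by the moments \<open>M0\<close> to \<open>M3\<close>.\<close>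
  define T0 T1 T2 where "T0 = u (D (S f))" and "T1 = u (D (S (pCons 0 f)))"
    and "T2 = u (D (S (pCons 0 (pCons 0 f))))"
  define X0 X1 Y0 where "X0 = u (pCons 0 (D (S f)))" and "X1 = u (pCons 0 (D (S (pCons 0 f))))"
    and "Y0 = u (pCons 0 (pCons 0 (D (S f))))"
  define R0 R1 where "R0 = u (R f)" and "R1 = u (pCons 0 (R f))"
  note fold = T0_def[symmetric] T1_def[symmetric] T2_def[symmetric] X0_def[symmetric]
    X1_def[symmetric] Y0_def[symmetric] R0_def[symmetric] R1_def[symmetric] M a_def[symmetric] b2[symmetric]
  have T: "r * (1 - r\<^sup>2) * T0 = 2 * M1" "r * (1 - r\<^sup>2) * T1 = 2 * M2" "r * (1 - r\<^sup>2) * T2 = 2 * M3"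
    and X: "2 * r ^ 3 * (1 - r\<^sup>2) * X0 = 4 * M2 - (1 - r ^ 4) * M0"
      "2 * r ^ 3 * (1 - r\<^sup>2) * X1 = 4 * M3 - (1 - r ^ 4) * M1"
    using N0[of f] N0[of "pCons 0 f"] N0[of "pCons 0 (pCons 0 f)"] N1[of f] N1[of "pCons 0 f"]
    unfolding fold by blast+
  \<comment> \<open>The product rule for \<open>D S\<close> is solved for \<open>R0\<close>, since
    \<open>T1\<close> and \<open>X0\<close> are known. The factor \<open>1 - r ^ 4\<close> clears
    denominators and is nonzero because \<open>C 1\<close> is.\<close>
  have R0: "2 * r ^ 4 * R0 = - 4 * M2 + (1 + r ^ 4) * M0"
  proof -
    have T1: "a * R0 + b * X0 = T1"
      unfolding fold[symmetric] Dq_Sq_pCons u_add u_smult ..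
    have "(1 - r ^ 4) * (2 * r ^ 4 * R0) = 2 * r ^ 4 * (1 - r\<^sup>2) * (r\<^sup>2 + 1) * R0"
      by algebra
    also have "\<dots> = 4 * r ^ 4 * (r * (1 - r\<^sup>2) * (a * R0 + b * X0))
        - (2 * b * r\<^sup>2) * (2 * r ^ 3 * (1 - r\<^sup>2) * X0)"
      unfolding a[symmetric] by algebra
    also have "\<dots> = (1 - r ^ 4) * (- 4 * M2 + (1 + r ^ 4) * M0)"
      unfolding T1 T b X by algebra
    finally show ?thesis using nz by simp
  qed
  \<comment> \<open>\<open>Dq_Sq_pCons_pCons\<close> under \<open>u\<close> has \<open>Y0\<close> as
    its only unknown.\<close>
  have Y: "r ^ 5 * (1 - r\<^sup>2) * Y0 = 2 * M3 - (1 - r ^ 4) * M1"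
  proof -
    have "T2 - (2 * b) * X1 + Y0 = (1 - b\<^sup>2) * T0"
      using arg_cong[OF Dq_Sq_pCons_pCons[of f], of u]
      unfolding u_add u_diff u_smult fold .
    then have "4 * (r ^ 5 * (1 - r\<^sup>2) * Y0) = (4 * r ^ 4 - (2 * b * r\<^sup>2)\<^sup>2) * (r * (1 - r\<^sup>2) * T0)
        - 4 * r ^ 4 * (r * (1 - r\<^sup>2) * T2) + 2 * (2 * b * r\<^sup>2) * (2 * r ^ 3 * (1 - r\<^sup>2) * X1)"
      by algebra
    also have "\<dots> = 4 * (2 * M3 - (1 - r ^ 4) * M1)"
      unfolding b T X by algebra
    finally show ?thesis unfolding mult_cancel_left by simp
  qed
  \<comment> \<open>As for \<open>R0\<close>, with the product rule multiplied once by the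
    variable.\<close>
  have R1: "r ^ 6 * R1 = M1 - 2 * M3"
  proof -
    have X1: "a * R1 + b * Y0 = X1"
      unfolding fold[symmetric] Dq_Sq_pCons pCons_0_linear u_add u_smult ..
    have "(1 - r ^ 4) * (r ^ 6 * R1) = r ^ 6 * (1 - r\<^sup>2) * (r\<^sup>2 + 1) * R1"
      by algebra
    also have "\<dots> = r ^ 4 * (2 * r ^ 3 * (1 - r\<^sup>2) * (a * R1 + b * Y0))
        - (2 * b * r\<^sup>2) * (r ^ 5 * (1 - r\<^sup>2) * Y0)"
      unfolding a[symmetric] by algebra
    also have "\<dots> = (1 - r ^ 4) * (M1 - 2 * M3)"
      unfolding X1 b X Y by algebra
    finally show ?thesis using nz by simp
  qed
  show "r * (r\<^sup>2 - 1) * - u (D (S f)) = 2 * u (pCons 0 f)"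
    unfolding fold using T(1) by algebra
  have "2 * u (S (S f)) = R0 + M0"
    by (simp add: R0_def R_def M0_def)
  then have "4 * r ^ 4 * u (S (S f)) = 2 * r ^ 4 * R0 + 2 * r ^ 4 * M0"
    by algebra
  then show "4 * r ^ 4 * u (S (S f)) = - 4 * u (pCons 0 (pCons 0 f)) + (1 + 3 * r ^ 4) * u f"
    unfolding fold R0 by algebra
  define W where "W = u (pCons 0 (pCons 0 (D (D f)))) - a\<^sup>2 * u (D (D f))"
  have W: "2 * (a\<^sup>2 - 1) * W = a * (R0 - M0) - 2 * (a\<^sup>2 - 1) * X0"
    using arg_cong[OF weighted_Dq_Dq[of f], of u] unfolding u_diff u_smult fold W_def .
  have "2 * (4 * (a\<^sup>2 - 1) * r ^ 5 * W) = 4 * r ^ 5 * (2 * (a\<^sup>2 - 1) * W)"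
    by algebra
  \<comment> \<open>By \<open>a\<close>, \<open>4 * r\<^sup>2 * (a\<^sup>2 - 1)\<close> is the
    square of \<open>1 - r\<^sup>2\<close>; this supplies the factor required by
    \<open>X\<close>.\<close>
  also have "\<dots> = (2 * a * r) * (2 * r ^ 4 * R0 - 2 * r ^ 4 * M0)
      - ((2 * a * r)\<^sup>2 - 4 * r\<^sup>2) * (2 * r ^ 3 * X0)"
    unfolding W by algebra
  also have "\<dots> = (r\<^sup>2 + 1) * (2 * r ^ 4 * R0 - 2 * r ^ 4 * M0) - (1 - r\<^sup>2) * (2 * r ^ 3 * (1 - r\<^sup>2) * X0)"
    unfolding a by algebra
  also have "\<dots> = 2 * (- 4 * M2 + (1 - r ^ 4) * M0)"
    unfolding R0 X by algebra
  finally have "4 * (a\<^sup>2 - 1) * r ^ 5 * W = - 4 * M2 + (1 - r ^ 4) * M0"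
    unfolding mult_cancel_left by simp
  then show "4 * (\<alpha>\<^sup>2 - 1) * r ^ 5 * (u (pCons 0 (pCons 0 (D (D f)))) - \<alpha>\<^sup>2 * u (D (D f)))
      = - 4 * u (pCons 0 (pCons 0 f)) + (1 - r ^ 4) * u f"
    unfolding fold W_def .
  define V where "V = u (pCons 0 (pCons 0 (S (D f)))) - a\<^sup>2 * u (S (D f))"
  have V: "2 * V = (2 * a) * (Y0 - T0) - (R1 - M1)"
    using arg_cong[OF weighted_Sq_Dq[of f], of u] unfolding pCons_0_linear u_diff u_smult fold V_def .
  have "2 * r ^ 6 * (1 - r\<^sup>2) * - V = - (r ^ 6 * (1 - r\<^sup>2)) * (2 * V)"
    by algebra
  also have "\<dots> = - (2 * a * r) * (r ^ 5 * (1 - r\<^sup>2) * Y0 - r ^ 4 * (r * (1 - r\<^sup>2) * T0))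
      + (1 - r\<^sup>2) * (r ^ 6 * R1 - r ^ 6 * M1)"
    unfolding V by algebra
  also have "\<dots> = - 4 * M3 + (r ^ 8 + r ^ 4 + 2) * M1"
    unfolding a Y T R1 by algebra
  finally show "2 * r ^ 6 * (1 - r\<^sup>2) * - (u (pCons 0 (pCons 0 (S (D f)))) - \<alpha>\<^sup>2 * u (S (D f)))
      = - 4 * u (pCons 0 (pCons 0 (pCons 0 f))) + (r ^ 8 + r ^ 4 + 2) * u (pCons 0 f)"
    unfolding fold V_def .
qed

lemma u_coefficient_mult:
  "u (2 * polyvar * f) = 2 * u (pCons 0 f)"
  "u ((polyvar\<^sup>2 - polyconst c) * f) = u (pCons 0 (pCons 0 f)) - of_real c * u f"
  "u ((- 4 * polyvar\<^sup>2 + 1 - polyconst c) * f) = - 4 * u (pCons 0 (pCons 0 f)) + (1 - of_real c) * u f"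
  "u ((- 4 * polyvar\<^sup>2 + 1 + 3 * polyconst c) * f) = - 4 * u (pCons 0 (pCons 0 f)) + (1 + 3 * of_real c) * u f"
  "u (polyvar * (- 4 * polyvar\<^sup>2 + polyconst c + polyconst d + 2) * f)
    = - 4 * u (pCons 0 (pCons 0 (pCons 0 f))) + (of_real c + of_real d + 2) * u (pCons 0 f)"
proof -
  have eqI: "u p = u p'" if "\<And>x. poly p x = poly p' x" for p p'
    using that by (metis poly_eq_poly_eq_iff ext)
  have "u (2 * polyvar * f) = u (smult 2 (pCons 0 f))"
    by (rule eqI) (simp add: algebra_simps)
  then show "u (2 * polyvar * f) = 2 * u (pCons 0 f)"
    by (simp only: u_smult)
  have "u ((polyvar\<^sup>2 - polyconst c) * f) = u (pCons 0 (pCons 0 f) - smult (of_real c) f)"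
    by (rule eqI) (simp add: algebra_simps power2_eq_square)
  then show "u ((polyvar\<^sup>2 - polyconst c) * f) = u (pCons 0 (pCons 0 f)) - of_real c * u f"
    by (simp only: u_smult u_diff)
  have "u ((- 4 * polyvar\<^sup>2 + 1 - polyconst c) * f)
      = u (smult (- 4) (pCons 0 (pCons 0 f)) + smult (1 - of_real c) f)"
    by (rule eqI) (simp add: algebra_simps power2_eq_square)
  then show "u ((- 4 * polyvar\<^sup>2 + 1 - polyconst c) * f)
      = - 4 * u (pCons 0 (pCons 0 f)) + (1 - of_real c) * u f"
    by (simp only: u_smult u_add)
  have "u ((- 4 * polyvar\<^sup>2 + 1 + 3 * polyconst c) * f)
      = u (smult (- 4) (pCons 0 (pCons 0 f)) + smult (1 + 3 * of_real c) f)"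
    by (rule eqI) (simp add: algebra_simps power2_eq_square)
  then show "u ((- 4 * polyvar\<^sup>2 + 1 + 3 * polyconst c) * f)
      = - 4 * u (pCons 0 (pCons 0 f)) + (1 + 3 * of_real c) * u f"
    by (simp only: u_smult u_add)
  have "u (polyvar * (- 4 * polyvar\<^sup>2 + polyconst c + polyconst d + 2) * f)
      = u (smult (- 4) (pCons 0 (pCons 0 (pCons 0 f))) + smult (of_real c + of_real d + 2) (pCons 0 f))"
    by (rule eqI) (simp add: algebra_simps power2_eq_square)
  then show "u (polyvar * (- 4 * polyvar\<^sup>2 + polyconst c + polyconst d + 2) * f)
      = - 4 * u (pCons 0 (pCons 0 (pCons 0 f))) + (of_real c + of_real d + 2) * u (pCons 0 f)"
    by (simp only: u_smult u_add)
qed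

lemma functional_equations_of_lowering:
  assumes lower: "\<And>n. D (S (P n)) = smult (k n) (if n = 0 then 0 else P (n - 1))"
  obtains s r where "s \<in> {1, -1 :: real}" "r = complex_of_real (q powr (s / 2))"
    "\<And>f. r * (r\<^sup>2 - 1) * - u (D (S f)) = 2 * u (pCons 0 f)"
    "\<And>f. 4 * (\<alpha>\<^sup>2 - 1) * r ^ 5 * (u (pCons 0 (pCons 0 (D (D f)))) - \<alpha>\<^sup>2 * u (D (D f)))
      = - 4 * u (pCons 0 (pCons 0 f)) + (1 - r ^ 4) * u f"
    "\<And>f. 4 * r ^ 4 * u (S (S f)) = - 4 * u (pCons 0 (pCons 0 f)) + (1 + 3 * r ^ 4) * u f"
    "\<And>f. 2 * r ^ 6 * (1 - r\<^sup>2) * - (u (pCons 0 (pCons 0 (S (D f)))) - \<alpha>\<^sup>2 * u (S (D f)))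
      = - 4 * u (pCons 0 (pCons 0 (pCons 0 f))) + (r ^ 8 + r ^ 4 + 2) * u (pCons 0 f)"
proof -
  obtain B C where C: "C 0 = 0" "\<And>n. C (Suc n) \<noteq> 0"
    and rec: "\<And>n. pCons 0 (P n) = P (Suc n) + smult (B n) (P n) + smult (C n) (P (n - 1))"
    by (rule three_term_recurrence) (rule that)
  obtain Q where Q: "Q\<^sup>2 + (2 - 4 * \<alpha>\<^sub>2\<^sup>2) * Q + 1 = 0"
    and B: "B 0 = 0" "B 1 = 0" and C12: "C 1 = (1 - Q) / 4" "C 2 = (1 - Q\<^sup>2) / 4"
    and k: "k 1 = \<alpha>" "k 2 = 2 * \<alpha>\<^sub>2 * \<alpha>"
    by (rule lowering_recurrence_coefficients[OF lower C rec])
  have "\<exists>s\<in>{1, -1}. Q = of_real (q powr (s / 2)) ^ 4"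
  proof -
    define x y where "x = complex_of_real (q powr (1 / 2))" and "y = complex_of_real (q powr (- 1 / 2))"
    have "q powr (1/2) * q powr (- 1/2) = 1"
      using q_pos by (simp flip: powr_add)
    then have xy: "x * y = 1" unfolding x_def y_def by (simp flip: of_real_mult)
    have "2 * aw_alpha q * q powr (1/2) = (q powr (1/2))\<^sup>2 + 1"
      using two_alpha_mult_root[of 1] by simp
    then have "complex_of_real (2 * aw_alpha q * q powr (1/2)) = of_real ((q powr (1/2))\<^sup>2 + 1)"
      by (simp only:)
    then have "2 * \<alpha> * x = x\<^sup>2 + 1" by (simp add: x_def)
    then have "2 * \<alpha> = x + y" using xy by algebra
    then have "4 * \<alpha>\<^sup>2 = x\<^sup>2 + y\<^sup>2 + 2" using xy by algebra
    then have "2 * \<alpha>\<^sub>2 = x\<^sup>2 + y\<^sup>2" by algebra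
    then have "4 * \<alpha>\<^sub>2\<^sup>2 = x ^ 4 + y ^ 4 + 2" using xy by algebra
    moreover have "x ^ 4 * y ^ 4 = 1" using xy by algebra
    \<comment> \<open>The sum and product of x^4 and y^4 match the coefficients of the quadratic for
      \<open>Q\<close>, so its roots are q^2 and q^(-2).\<close>
    ultimately have "(Q - x ^ 4) * (Q - y ^ 4) = 0" using Q by algebra
    then show ?thesis unfolding x_def y_def by auto
  qed
  then obtain s where s: "s \<in> {1, -1 :: real}" and Qs: "Q = of_real (q powr (s / 2)) ^ 4" by blast
  define t where "t = q powr (s / 2)"
  define r where "r = complex_of_real t"
  have r: "r \<noteq> 0" using q_pos by (simp add: r_def t_def)
  have "complex_of_real (2 * aw_alpha q * t) = of_real (t\<^sup>2 + 1)"
    using two_alpha_mult_root[OF s t_def] by (simp only:)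
  then have alr: "2 * \<alpha> * r = r\<^sup>2 + 1" by (simp add: r_def)
  have Qr: "Q = r ^ 4" using Qs by (simp add: r_def t_def)
  have C1: "4 * C 1 = 1 - r ^ 4" and C2: "4 * C 2 = 1 - r ^ 8"
    unfolding C12 Qr by simp_all
  show thesis
    by (rule that[OF s _ functional_equations[OF lower C rec B C1 C2 k r alr]]) (simp add: r_def t_def)
qed


section \<open>From the functional equations to the lowering relation\<close>

text \<open>The product rules at \<open>pCons 0 f\<close> are solved for the terms with one more
  factor of the variable outside. \<open>D S\<close> and \<open>R\<close> must be carried together
  because each rule involves both.\<close>

lemma adjoint_degree_bounds:
  assumes A0: "degree A0 \<le> 1" "\<And>f. u (D (S f)) = u (A0 * f)"
    and B0: "degree B0 \<le> 2" "\<And>f. u (R f) = u (B0 * f)"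
  shows "\<exists>A B. degree A \<le> j + 1 \<and> degree B \<le> j + 2 \<and>
    (\<forall>f. u (monom 1 j * D (S f)) = u (A * f) \<and> u (monom 1 j * R f) = u (B * f))"
proof (induction j)
  case 0
  then show ?case using assms by (intro exI[of _ A0] exI[of _ B0]) simp
next
  case (Suc j)
  then obtain A B where deg: "degree A \<le> j + 1" "degree B \<le> j + 2"
    and A: "\<And>f. u (monom 1 j * D (S f)) = u (A * f)" and B: "\<And>f. u (monom 1 j * R f) = u (B * f)"
    by blast
  define A' where "A' = smult (1 / \<alpha>\<^sub>2) (pCons 0 A - smult \<alpha> B)"
  \<comment> \<open>The two product rules are linear in \<open>u (monom 1 (Suc j) * R f)\<close> and
    \<open>u (monom 1 (j + 2) * D (S f))\<close>. Eliminating the latter leaves the coefficient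
    \<open>\<alpha>\<close>, because \<open>\<alpha>\<^sub>2\<^sup>2 - (\<alpha>\<^sub>2\<^sup>2 -
    1) = 1\<close>.\<close>
  define B' where "B' = smult \<alpha>\<^sub>2 (pCons 0 B)
    - smult ((\<alpha>\<^sub>2\<^sup>2 - 1) / \<alpha>) (pCons 0 A' - smult \<alpha>\<^sub>2 A)"
  have m: "monom 1 j * pCons 0 f = monom 1 (Suc j) * f"
    "monom 1 (Suc j) * pCons 0 f = monom 1 (Suc (Suc j)) * f" for f :: "complex poly"
    by (simp_all add: monom_Suc)
  have A': "u (monom 1 (Suc j) * D (S f)) = u (A' * f)" for f
  proof -
    have "u (monom 1 j * D (S (pCons 0 f))) = \<alpha> * u (monom 1 j * R f) + \<alpha>\<^sub>2 * u (monom 1 (Suc j) * D (S f))"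
      unfolding Dq_Sq_pCons by (simp only: distrib_left mult_smult_right u_add u_smult m)
    then show ?thesis unfolding A B using alpha_nonzero
      by (simp add: A'_def left_diff_distrib pCons_0_linear del: add_pCons diff_pCons smult_pCons) (simp add: field_simps)
  qed
  have B': "u (monom 1 (Suc j) * R f) = u (B' * f)" for f
  proof -
    have 1: "u (A' * pCons 0 f) = \<alpha> * u (monom 1 (Suc j) * R f) + \<alpha>\<^sub>2 * u (monom 1 (Suc (Suc j)) * D (S f))"
      unfolding A'[symmetric] Dq_Sq_pCons by (simp only: distrib_left mult_smult_right u_add u_smult m)
    have "\<alpha> * u (monom 1 j * R (pCons 0 f)) = u (monom 1 j * (smult \<alpha> (R (pCons 0 f))))"
      by (simp only: mult_smult_right u_smult)
    also have "\<dots> = \<alpha>\<^sub>2 * \<alpha> * u (monom 1 (Suc j) * R f)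
        + (\<alpha>\<^sub>2\<^sup>2 - 1) * (u (monom 1 (Suc (Suc j)) * D (S f)) - u (monom 1 j * D (S f)))"
      unfolding R_pCons by (simp only: distrib_left mult_smult_right u_add u_smult m
          right_diff_distrib u_diff mult_zero_right pCons_0_0 u_0 add_0_left)
    finally have 2: "\<alpha> * u (B * pCons 0 f) = \<alpha>\<^sub>2 * \<alpha> * u (monom 1 (Suc j) * R f)
        + (\<alpha>\<^sub>2\<^sup>2 - 1) * (u (monom 1 (Suc (Suc j)) * D (S f)) - u (A * f))"
      unfolding A B .
    have "\<alpha> * u (monom 1 (Suc j) * R f) = \<alpha> * \<alpha>\<^sub>2 * u (B * pCons 0 f)
        - (\<alpha>\<^sub>2\<^sup>2 - 1) * (u (A' * pCons 0 f) - \<alpha>\<^sub>2 * u (A * f))"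
      using 1 2 by algebra
    also have "\<dots> = \<alpha> * u (B' * f)"
      using alpha_nonzero(1) by (simp add: B'_def left_diff_distrib pCons_0_linear del: add_pCons diff_pCons smult_pCons) (simp add: field_simps)
    finally show ?thesis using alpha_nonzero(1) by simp
  qed
  have "degree A' \<le> Suc j + 1"
    unfolding A'_def using deg
    by (intro degree_diff_le order.trans[OF degree_smult_le] order.trans[OF degree_pCons_le]) auto
  moreover from this have "degree B' \<le> Suc j + 2"
    unfolding B'_def using deg
    by (intro degree_diff_le order.trans[OF degree_smult_le] order.trans[OF degree_pCons_le]) auto
  ultimately show ?case using A' B' by blast
qed

text \<open>Moving \<open>D S\<close> from \<open>P n\<close> to the other factor raises its degree
  by at most one, so \<open>D (S (P n))\<close> is orthogonal to degrees below n - 1; its own degree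
  is at most n - 1.\<close>

lemma lowering_from_adjoint:
  assumes "degree A0 \<le> 1" "\<And>f. u (D (S f)) = u (A0 * f)"
    and "degree B0 \<le> 2" "\<And>f. u (R f) = u (B0 * f)"
  shows "\<exists>k. \<forall>n. D (S (P n)) = smult (k n) (if n = 0 then 0 else P (n - 1))"
proof -
  have "\<exists>k. D (S (P n)) = smult k (if n = 0 then 0 else P (n - 1))" for n
  proof (cases n)
    case 0
    then show ?thesis using P_0 by (simp add: one_pCons)
  next
    case (Suc m)
    define F where "F = D (S (P n))"
    have deg: "degree F \<le> m" using degree_Dq_Sq[of "P n"] Suc by (auto simp: F_def)
    have low: "u (p * F) = 0" if "degree p < m" for p
    proof -
      have "u (monom 1 j * F) = 0" if "j < m" for j
      proof -
        obtain A where "degree A \<le> j + 1" "u (monom 1 j * F) = u (A * P n)"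
          using adjoint_degree_bounds[OF assms, of j] unfolding F_def by blast
        then show ?thesis
          using u_P_mult[of A n] that Suc by (simp add: mult.commute coeff_eq_0)
      qed
      then have *: "(\<Sum>j\<in>J. u (monom (coeff p j) j * F)) = 0" if "J \<subseteq> {..<m}" for J
        using that by (intro sum.neutral ballI)
          (metis lessThan_iff mult_smult_left mult_zero_right smult_monom mult_1_right subsetD u_smult)
      have "u (\<Sum>j\<in>J. G j) = (\<Sum>j\<in>J. u (G j))" if "finite J" for G and J :: "nat set"
        using that by induction auto
      then have "u ((\<Sum>j\<le>degree p. monom (coeff p j) j) * F) = 0"
        using *[of "{..degree p}"] that by (simp add: sum_distrib_right subset_iff)
      then show ?thesis by (simp add: poly_as_sum_of_monoms)
    qed
    \<comment> \<open>The scalar is the coefficient of the orthogonal projection of \<open>F\<close>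
      to \<open>P m\<close>.\<close>
    have "F - smult (u (P m * F) / h m) (P m) = 0"
    proof (rule eq_0I)
      fix j
      consider "j < m" | "j = m" | "j > m" by linarith
      then show "u (P j * (F - smult (u (P m * F) / h m) (P m))) = 0"
      proof cases
        case 3
        then show ?thesis using u_P_mult[of F j] deg
          by (simp add: right_diff_distrib ortho coeff_eq_0)
      qed (simp_all add: right_diff_distrib ortho low)
    qed
    then show ?thesis using Suc unfolding F_def by auto
  qed
  then show ?thesis by metis
qed

text \<open>The first assumed equation gives the multiplier of \<open>D S\<close> under
  \<open>u\<close>; the second, rewritten with R f = 2 S (S f) - f, gives that of
  \<open>R\<close>.\<close>

lemma lowering_of_functional_equations:
  assumes r: "r \<noteq> 0" and r2: "r\<^sup>2 - 1 \<noteq> 0"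
    and T: "\<And>f. r * (r\<^sup>2 - 1) * - u (D (S f)) = 2 * u (pCons 0 f)"
    and S2: "\<And>f. 4 * r ^ 4 * u (S (S f)) = - 4 * u (pCons 0 (pCons 0 f)) + (1 + 3 * r ^ 4) * u f"
  shows "\<exists>k. \<forall>n. D (S (P n)) = smult (k n) (if n = 0 then 0 else P (n - 1))"
proof -
  have 1: "u (D (S f)) = u ([:0, - 2 / (r * (r\<^sup>2 - 1)):] * f)" for f
  proof -
    have "[:0, - 2 / (r * (r\<^sup>2 - 1)):] * f = smult (- 2 / (r * (r\<^sup>2 - 1))) (pCons 0 f)"
      by simp
    moreover have "u (D (S f)) * (r * (r\<^sup>2 - 1)) = - 2 * u (pCons 0 f)"
      using T[of f] by algebra
    ultimately show ?thesis
      using r r2 by (simp only: u_smult times_divide_eq_left eq_divide_eq mult_eq_0_iff) simp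
  qed
  have 2: "u (R f) = u ([:(1 + r ^ 4) / (2 * r ^ 4), 0, - 2 / r ^ 4:] * f)" for f
  proof -
    have "[:(1 + r ^ 4) / (2 * r ^ 4), 0, - 2 / r ^ 4:] * f
        = smult (1 / (2 * r ^ 4)) (smult (1 + r ^ 4) f - smult 4 (pCons 0 (pCons 0 f)))"
      by (simp add: smult_diff_right)
    moreover have "2 * u (S (S f)) = u (R f) + u f" by (simp add: R_def)
    then have "u (R f) * (2 * r ^ 4) = (1 + r ^ 4) * u f - 4 * u (pCons 0 (pCons 0 f))"
      using S2[of f] by algebra
    ultimately show ?thesis
      using r by (simp only: u_smult u_diff times_divide_eq_left eq_divide_eq mult_eq_0_iff) simp
  qed
  show "\<exists>k. \<forall>n. D (S (P n)) = smult (k n) (if n = 0 then 0 else P (n - 1))"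
    by (rule lowering_from_adjoint[OF _ 1 _ 2]) (simp_all add: degree_pCons_eq_if)
qed


end


section \<open>The characterization\<close>

theorem theorem4p2:
  fixes q :: real and u :: "complex poly \<Rightarrow> complex" and P :: "nat \<Rightarrow> complex poly"
  assumes "0 < q" and "q < 1"
    and "regular_functional u"
    and "is_monic_OPS u P"
  shows "(\<exists>k :: nat \<Rightarrow> complex. \<forall>n.
            aw_Dq q (aw_Sq q (P n)) = smult (k n) (if n = 0 then 0 else P (n - 1)))
    \<longleftrightarrow>
    (\<exists>s \<in> {1, -1 :: real}.
       dual_scale (of_real (q powr (s / 2) * (q powr s - 1))) (dual_Sq q (dual_Dq q u))
         = dual_mult (2 * polyvar) u
     \<and> dual_scale (of_real (4 * ((aw_alpha q)^2 - 1) * q powr (5 * s / 2)))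
         (dual_Dq q (dual_Dq q (dual_mult (polyvar^2 - polyconst ((aw_alpha q)^2)) u)))
         = dual_mult (- 4 * polyvar^2 + 1 - polyconst (q powr (2 * s))) u
     \<and> dual_scale (of_real (4 * q powr (2 * s))) (dual_Sq q (dual_Sq q u))
         = dual_mult (- 4 * polyvar^2 + 1 + 3 * polyconst (q powr (2 * s))) u
     \<and> dual_scale (of_real (2 * q powr (3 * s) * (1 - q powr s)))
         (dual_Dq q (dual_Sq q (dual_mult (polyvar^2 - polyconst ((aw_alpha q)^2)) u)))
         = dual_mult (polyvar * (- 4 * polyvar^2 + polyconst (q powr (4 * s))
             + polyconst (q powr (2 * s)) + 2)) u)" (is "?L \<longleftrightarrow> (\<exists>s\<in>_. ?E s)")
proof -
  obtain h where h: "\<And>n. h n \<noteq> 0" "\<And>j n. u (P j * P n) = (if j = n then h n else 0)"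
    and P: "\<And>n. degree (P n) = n" "\<And>n. lead_coeff (P n) = 1"
    using assms(4) unfolding is_monic_OPS_def by blast
  have "coeff (P n) n = 1" for n using P[of n] by simp
  then interpret askey_wilson_OPS q u P h
    using h P(1) assms(1-3) by unfold_locales (simp_all add: regular_functional_def)
  \<comment> \<open>Transposition reverses compositions: \<open>dual_Sq q (dual_Dq q u)\<close>
    takes \<open>f\<close> to \<open>- u (D (S f))\<close>, so it encodes \<open>D S\<close> and not
    \<open>S D\<close>.\<close>
  note duals = fun_eq_iff dual_scale_def dual_mult_def dual_Dq_def dual_Sq_def u_coefficient_mult
  show ?thesis
  proof
    assume ?L
    then obtain k where "\<And>n. aw_Dq q (aw_Sq q (P n)) = smult (k n) (if n = 0 then 0 else P (n - 1))"
      by blast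
    then obtain s r where s: "s \<in> {1, -1 :: real}" and r: "r = complex_of_real (q powr (s / 2))"
      and eqs: "\<And>f. r * (r\<^sup>2 - 1) * - u (aw_Dq q (aw_Sq q f)) = 2 * u (pCons 0 f)"
        "\<And>f. 4 * ((of_real (aw_alpha q))\<^sup>2 - 1) * r ^ 5 *
          (u (pCons 0 (pCons 0 (aw_Dq q (aw_Dq q f)))) - (of_real (aw_alpha q))\<^sup>2 * u (aw_Dq q (aw_Dq q f)))
          = - 4 * u (pCons 0 (pCons 0 f)) + (1 - r ^ 4) * u f"
        "\<And>f. 4 * r ^ 4 * u (aw_Sq q (aw_Sq q f))
          = - 4 * u (pCons 0 (pCons 0 f)) + (1 + 3 * r ^ 4) * u f"
        "\<And>f. 2 * r ^ 6 * (1 - r\<^sup>2) *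
          - (u (pCons 0 (pCons 0 (aw_Sq q (aw_Dq q f)))) - (of_real (aw_alpha q))\<^sup>2 * u (aw_Sq q (aw_Dq q f)))
          = - 4 * u (pCons 0 (pCons 0 (pCons 0 f))) + (r ^ 8 + r ^ 4 + 2) * u (pCons 0 f)"
      by (rule functional_equations_of_lowering) (rule that)
    define t where "t = q powr (s / 2)"
    have "?E s"
      unfolding duals powr_root[OF t_def] t_def[symmetric]
      using eqs by (simp add: r t_def)
    with s show "\<exists>s\<in>{1, -1}. ?E s" by blast
  next
    assume "\<exists>s\<in>{1, -1}. ?E s"
    then obtain s where s: "s \<in> {1, -1 :: real}" and E: "?E s" by blast
    define t where "t = q powr (s / 2)"
    define r where "r = complex_of_real t"
    have "t \<noteq> 0" using assms(1) by (simp add: t_def)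
    then have r: "r \<noteq> 0" by (simp add: r_def)
    have "q powr s \<noteq> 1" using s assms(1,2) by (auto simp: powr_minus)
    then have "t\<^sup>2 \<noteq> 1" unfolding powr_root(1)[OF t_def] .
    then have r2: "r\<^sup>2 - 1 \<noteq> 0" unfolding r_def
      by (metis of_real_1 of_real_eq_iff of_real_power right_minus_eq)
    have "r * (r\<^sup>2 - 1) * - u (aw_Dq q (aw_Sq q f)) = 2 * u (pCons 0 f)"
      "4 * r ^ 4 * u (aw_Sq q (aw_Sq q f)) = - 4 * u (pCons 0 (pCons 0 f)) + (1 + 3 * r ^ 4) * u f" for f
      using E unfolding duals powr_root[OF t_def] t_def[symmetric]
      by (simp_all add: r_def)
    then show ?L by (rule lowering_of_functional_equations[OF r r2])
  qed
qed

end
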